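(* Let $\varphi\in L^2(\mathbb{R}^2,\mathbb{H})$ be a quaternion window function (i.e. $\varphi$ is not the zero function), and let $f\in L^2(\mathbb{R}^2,\mathbb{H})$ be such that $\mathcal{G}_\varphi f\in L^2(\mathbb{R}^2\times\mathbb{R}^2,\mathbb{H})$ and the functions $(\omega,b)\mapsto\omega_k\,\mathcal{G}_\varphi f(\omega,b)$, $k=1,2$, belong to $L^2(\mathbb{R}^2\times\mathbb{R}^2,\mathbb{H})$. Then, for $k=1,2$, $$\left(\int_{\mathbb{R}^2}x_k^2|f(x)|^2dx\right)^{\frac12}\left(\int_{\mathbb{R}^2}\int_{\mathbb{R}^2}\omega_k^2|\mathcal{G}_\varphi f(\omega,b)|^2\,d\omega\,db\right)^{\frac12}\ \geq\ \frac{1}{4\pi}\,\|f\|_2^2\,\|\varphi\|_2 .$$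
   Context: $\mathbb{H}$ is the real quaternion algebra with units $i,j,k$ ($i^2=j^2=k^2=ijk=-1$), conjugation $\overline{q}$ and modulus $|q|=\sqrt{q\overline{q}}$. $L^2(\mathbb{R}^2,\mathbb{H})$ is the space of measurable $f:\mathbb{R}^2\to\mathbb{H}$ with $\|f\|_2^2=\int_{\mathbb{R}^2}|f(x)|^2dx<\infty$, and similarly for $L^2(\mathbb{R}^2\times\mathbb{R}^2,\mathbb{H})$. Integrals of non-negative functions take values in $[0,\infty]$. The Gabor quaternionic Fourier transform (GQFT) of $f\in L^2(\mathbb{R}^2,\mathbb{H})$ with respect to a non-zero window $\varphi\in L^2(\mathbb{R}^2,\mathbb{H})$ is $$\mathcal{G}_\varphi f(\omega,b)=\int_{\mathbb{R}^2}e^{-2\pi i x_1\omega_1}f(x)\overline{\varphi(x-b)}e^{-2\pi j x_2\omega_2}dx,\qquad \omega,b\in\mathbb{R}^2 .$$ Here $x=(x_1,x_2)$, $\omega=(\omega_1,\omega_2)$; the index $k\in\{1,2\}$ of a coordinate is unrelated to the quaternion unit $k$. *)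

theory Defs
  imports "HOL-Analysis.Analysis"
begin

section \<open>The real quaternions\<close>

text \<open>
  \<open>Quat a b c d\<close> stands for \<open>a + b i + c j + d k\<close>.  The type is made an instance of
  \<^class>\<open>real_normed_div_algebra\<close> and \<^class>\<open>euclidean_space\<close>, so that the library's
  exponential function, Borel \<open>\<sigma>\<close>-algebra and Bochner integral apply to it.
\<close>

datatype quat = Quat (qRe: real) (qI: real) (qJ: real) (qK: real)

lemma quat_eq_iff: "x = y \<longleftrightarrow> qRe x = qRe y \<and> qI x = qI y \<and> qJ x = qJ y \<and> qK x = qK y"
  by (cases x; cases y) simp

definition quat_i :: quat where "quat_i = Quat 0 1 0 0"
definition quat_j :: quat where "quat_j = Quat 0 0 1 0"
definition quat_k :: quat where "quat_k = Quat 0 0 0 1"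

definition qcnj :: "quat \<Rightarrow> quat" where
  "qcnj q = Quat (qRe q) (- qI q) (- qJ q) (- qK q)"

lemma qcnj_sel [simp]:
  "qRe (qcnj q) = qRe q" "qI (qcnj q) = - qI q" "qJ (qcnj q) = - qJ q" "qK (qcnj q) = - qK q"
  by (simp_all add: qcnj_def)

instantiation quat :: ring_1
begin

definition "0 = Quat 0 0 0 0"
definition "1 = Quat 1 0 0 0"
definition "x + y = Quat (qRe x + qRe y) (qI x + qI y) (qJ x + qJ y) (qK x + qK y)"
definition "- x = Quat (- qRe x) (- qI x) (- qJ x) (- qK x)"
definition "x - y = Quat (qRe x - qRe y) (qI x - qI y) (qJ x - qJ y) (qK x - qK y)"
definition "x * y = Quat
   (qRe x * qRe y - qI x * qI y - qJ x * qJ y - qK x * qK y)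
   (qRe x * qI y + qI x * qRe y + qJ x * qK y - qK x * qJ y)
   (qRe x * qJ y - qI x * qK y + qJ x * qRe y + qK x * qI y)
   (qRe x * qK y + qI x * qJ y - qJ x * qI y + qK x * qRe y)"

instance
  by standard
    (simp_all add: quat_eq_iff zero_quat_def one_quat_def plus_quat_def uminus_quat_def
      minus_quat_def times_quat_def algebra_simps)

end

lemma quat_ring_sel [simp]:
  "qRe 0 = 0" "qI 0 = 0" "qJ 0 = 0" "qK 0 = 0"
  "qRe 1 = 1" "qI 1 = 0" "qJ 1 = 0" "qK 1 = 0"
  "qRe (x + y) = qRe x + qRe y" "qI (x + y) = qI x + qI y"
  "qJ (x + y) = qJ x + qJ y" "qK (x + y) = qK x + qK y"
  "qRe (- x) = - qRe x" "qI (- x) = - qI x" "qJ (- x) = - qJ x" "qK (- x) = - qK x"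
  "qRe (x - y) = qRe x - qRe y" "qI (x - y) = qI x - qI y"
  "qJ (x - y) = qJ x - qJ y" "qK (x - y) = qK x - qK y"
  "qRe (x * y) = qRe x * qRe y - qI x * qI y - qJ x * qJ y - qK x * qK y"
  "qI (x * y) = qRe x * qI y + qI x * qRe y + qJ x * qK y - qK x * qJ y"
  "qJ (x * y) = qRe x * qJ y - qI x * qK y + qJ x * qRe y + qK x * qI y"
  "qK (x * y) = qRe x * qK y + qI x * qJ y - qJ x * qI y + qK x * qRe y"
  by (simp_all add: zero_quat_def one_quat_def plus_quat_def uminus_quat_def
      minus_quat_def times_quat_def)

lemma quat_unit_sel [simp]:
  "qRe quat_i = 0" "qI quat_i = 1" "qJ quat_i = 0" "qK quat_i = 0"
  "qRe quat_j = 0" "qI quat_j = 0" "qJ quat_j = 1" "qK quat_j = 0"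
  "qRe quat_k = 0" "qI quat_k = 0" "qJ quat_k = 0" "qK quat_k = 1"
  by (simp_all add: quat_i_def quat_j_def quat_k_def)

lemma quat_units:
  "quat_i * quat_i = -1" "quat_j * quat_j = -1" "quat_k * quat_k = -1"
  "quat_i * quat_j * quat_k = -1"
  by (simp_all add: quat_eq_iff)

instantiation quat :: real_algebra_1
begin

definition "r *\<^sub>R x = Quat (r * qRe x) (r * qI x) (r * qJ x) (r * qK x)"

instance
  by standard (simp_all add: quat_eq_iff scaleR_quat_def algebra_simps)

end

lemma quat_scaleR_sel [simp]:
  "qRe (r *\<^sub>R x) = r * qRe x" "qI (r *\<^sub>R x) = r * qI x"
  "qJ (r *\<^sub>R x) = r * qJ x" "qK (r *\<^sub>R x) = r * qK x"
  by (simp_all add: scaleR_quat_def)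

lemma quat_of_real_sel [simp]:
  "qRe (of_real r) = r" "qI (of_real r) = 0" "qJ (of_real r) = 0" "qK (of_real r) = 0"
  by (simp_all add: of_real_def)

instantiation quat :: real_inner
begin

text \<open>The product \<open>q * qcnj q\<close> is real and non-negative (see \<open>quat_mult_qcnj\<close> below), so
  the following is the modulus \<open>sqrt (q * qcnj q)\<close>.\<close>
definition norm_quat :: "quat \<Rightarrow> real" where "norm q = sqrt (qRe (q * qcnj q))"
definition "inner x y = qRe (x * qcnj y)" for x y :: quat
definition "sgn x = x /\<^sub>R norm x" for x :: quat
definition "dist x y = norm (x - y)" for x y :: quat
definition
  "(uniformity :: (quat \<times> quat) filter) = (INF e\<in>{0<..}. principal {(x, y). dist x y < e})"
definition
  "open (U :: quat set) \<longleftrightarrow> (\<forall>x\<in>U. eventually (\<lambda>(x', y). x' = x \<longrightarrow> y \<in> U) uniformity)"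

instance
proof
  fix x :: quat
  show "(inner x x = 0) = (x = 0)"
    by (simp add: inner_quat_def quat_eq_iff add_nonneg_eq_0_iff)
qed (simp_all add: norm_quat_def inner_quat_def sgn_quat_def dist_quat_def uniformity_quat_def
    open_quat_def algebra_simps)

end

lemma inner_quat: "inner x y = qRe x * qRe y + qI x * qI y + qJ x * qJ y + qK x * qK y"
  by (simp add: inner_quat_def)

lemma norm_quat: "norm q = sqrt ((qRe q)\<^sup>2 + (qI q)\<^sup>2 + (qJ q)\<^sup>2 + (qK q)\<^sup>2)"
  by (simp add: norm_quat_def power2_eq_square)

lemma norm_quat_square: "(norm q)\<^sup>2 = (qRe q)\<^sup>2 + (qI q)\<^sup>2 + (qJ q)\<^sup>2 + (qK q)\<^sup>2"
  by (simp add: norm_quat)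

lemma quat_mult_qcnj: "q * qcnj q = of_real ((norm q)\<^sup>2)"
  unfolding norm_quat_square by (simp add: quat_eq_iff power2_eq_square)

lemma qcnj_quat_mult: "qcnj q * q = of_real ((norm q)\<^sup>2)"
  unfolding norm_quat_square by (simp add: quat_eq_iff power2_eq_square)

instantiation quat :: real_normed_div_algebra
begin

definition "inverse q = qcnj q /\<^sub>R (norm q)\<^sup>2"
definition "divide x y = x * inverse y" for x y :: quat

instance
proof
  fix x y :: quat
  show "norm (x * y) = norm x * norm y"
    unfolding norm_quat real_sqrt_mult [symmetric]
    by (rule arg_cong [where f = sqrt], simp only: quat_ring_sel, algebra)
  show "x * inverse x = 1" if "x \<noteq> 0"
  proof -
    have "x * inverse x = (x * qcnj x) /\<^sub>R (norm x)\<^sup>2"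
      by (simp only: inverse_quat_def mult_scaleR_right)
    also have "\<dots> = of_real (inverse ((norm x)\<^sup>2) * (norm x)\<^sup>2)"
      by (simp only: quat_mult_qcnj scaleR_conv_of_real of_real_mult)
    also have "\<dots> = 1"
      using that by simp
    finally show ?thesis .
  qed
  show "inverse x * x = 1" if "x \<noteq> 0"
  proof -
    have "inverse x * x = (qcnj x * x) /\<^sub>R (norm x)\<^sup>2"
      by (simp only: inverse_quat_def mult_scaleR_left)
    also have "\<dots> = of_real (inverse ((norm x)\<^sup>2) * (norm x)\<^sup>2)"
      by (simp only: qcnj_quat_mult scaleR_conv_of_real of_real_mult)
    also have "\<dots> = 1"
      using that by simp
    finally show ?thesis .
  qed
  show "inverse (0 :: quat) = 0"
    by (simp add: inverse_quat_def)
  show "x div y = x * inverse y"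
    by (simp add: divide_quat_def)
qed

end

instantiation quat :: euclidean_space
begin

definition "Basis = {1, quat_i, quat_j, quat_k}"

instance
proof
  show "(Basis :: quat set) \<noteq> {}" and "finite (Basis :: quat set)"
    by (simp_all add: Basis_quat_def)
  have distinct: "quat_i \<noteq> 1" "quat_j \<noteq> 1" "quat_k \<noteq> 1"
    "quat_i \<noteq> quat_j" "quat_i \<noteq> quat_k" "quat_j \<noteq> quat_k"
    by (simp_all add: quat_eq_iff)
  show "inner u v = (if u = v then 1 else 0)" if "u \<in> Basis" "v \<in> Basis" for u v :: quat
    using that distinct distinct [symmetric] unfolding Basis_quat_def
    by (elim insertE emptyE) (simp_all add: inner_quat)
  show "(\<forall>u\<in>Basis. inner x u = 0) \<longleftrightarrow> x = 0" for x :: quat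
    unfolding Basis_quat_def ball_simps
    by (simp add: inner_quat quat_eq_iff [of x])
qed

end


section \<open>Square-integrable functions\<close>

text \<open>Square root on \<open>[0, \<infinity>]\<close>, with \<open>\<infinity>\<close> as the root of \<open>\<infinity>\<close>.\<close>
definition esqrt :: "ennreal \<Rightarrow> ennreal" where
  "esqrt x = (if x = \<infinity> then \<infinity> else ennreal (sqrt (enn2real x)))"

lemma esqrt_ennreal: "0 \<le> r \<Longrightarrow> esqrt (ennreal r) = ennreal (sqrt r)"
  by (simp add: esqrt_def)

lemma esqrt_square: "(esqrt x)\<^sup>2 = x"
  by (cases x) (simp_all add: esqrt_def power2_eq_square ennreal_top_mult flip: ennreal_mult)

definition L2norm :: "'a measure \<Rightarrow> ('a \<Rightarrow> 'b::real_normed_vector) \<Rightarrow> ennreal" where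
  "L2norm M f = esqrt (\<integral>\<^sup>+ x. ennreal ((norm (f x))\<^sup>2) \<partial>M)"

text \<open>Functions rather than almost-everywhere classes of functions.\<close>
definition L2 :: "'a measure \<Rightarrow> ('a \<Rightarrow> 'b::real_normed_vector) set" where
  "L2 M = {f \<in> borel_measurable M. L2norm M f < \<infinity>}"


section \<open>The Gabor quaternionic Fourier transform\<close>

definition GQFT :: "(real^2 \<Rightarrow> quat) \<Rightarrow> (real^2 \<Rightarrow> quat) \<Rightarrow> real^2 \<Rightarrow> real^2 \<Rightarrow> quat" where
  "GQFT \<phi> f \<omega> b =
     (LINT x|lebesgue. exp (- ((2 * pi * x$1 * \<omega>$1) *\<^sub>R quat_i)) * f x * qcnj (\<phi> (x - b)) *
        exp (- ((2 * pi * x$2 * \<omega>$2) *\<^sub>R quat_j)))"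

end

theory Submission
  imports Defs "HOL-Probability.Probability"
begin

text \<open>
  Heisenberg's inequality is proved with translations in place of derivatives.  Put
  \<open>\<Phi> (x, b) = f x * qcnj (\<phi> (x - b))\<close>, so that \<open>\<Phi> (\<cdot>, b)\<close> has two-sided quaternionic Fourier transform
  \<open>GQFT \<phi> f \<cdot> b\<close>, and \<open>\<parallel>\<Phi>\<parallel> = \<parallel>f\<parallel> \<parallel>\<phi>\<parallel>\<close>, \<open>\<parallel>x\<^sub>k \<Phi>\<parallel> = \<parallel>x\<^sub>k f\<parallel> \<parallel>\<phi>\<parallel>\<close> by Tonelli.  With \<open>e\<close> the \<open>k\<close>-th
  unit vector of the \<open>x\<close>-plane, translation invariance gives the exact identity
  \<open>\<integral> x\<^sub>k \<langle>\<Phi>(p), \<Phi>(p + t e) - \<Phi>(p - t e)\<rangle> dp = - t \<integral> \<langle>\<Phi>(p), \<Phi>(p + t e)\<rangle> dp\<close>.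
  The transform multiplies such a symmetric difference by a factor of modulus
  \<open>2 \<bar>sin (2 \<pi> t \<omega>\<^sub>k)\<bar> \<le> 4 \<pi> t \<bar>\<omega>\<^sub>k\<bar>\<close>, so by a one-sided Plancherel inequality the difference has norm
  at most \<open>4 \<pi> t \<parallel>\<omega>\<^sub>k GQFT \<phi> f\<parallel>\<close>.  Cauchy--Schwarz, division by \<open>t\<close> and \<open>t \<rightarrow> 0\<close> yield
  \<open>\<parallel>\<Phi>\<parallel>\<^sup>2 \<le> 4 \<pi> \<parallel>x\<^sub>k \<Phi>\<parallel> \<parallel>\<omega>\<^sub>k GQFT \<phi> f\<parallel>\<close>, and \<open>\<parallel>\<phi>\<parallel>\<close> cancels.
\<close>

section \<open>Quaternion exponentials\<close>

text \<open>The map \<open>h\<close> sends \<open>\<i>\<close> to \<open>q\<close> and, as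
  \<open>q * q = -1\<close>, is a bounded homomorphism of real algebras from the complex numbers. It
  therefore commutes with the exponential series, and Euler's formula carries over.\<close>

lemma exp_scaleR_imaginary_unit:
  fixes q :: "'a::{real_normed_algebra_1, banach}"
  assumes "q * q = -1"
  shows "exp (\<theta> *\<^sub>R q) = cos \<theta> *\<^sub>R 1 + sin \<theta> *\<^sub>R q"
proof -
  define h where "h = (\<lambda>z. Re z *\<^sub>R 1 + Im z *\<^sub>R q)"
  have h: "bounded_linear h"
    unfolding h_def
    by (intro bounded_linear_add bounded_linear_scaleR_const bounded_linear_Re bounded_linear_Im)
  have mult: "h (z * w) = h z * h w" for z w
    by (simp add: h_def algebra_simps assms)
  have pow: "h (z ^ n) = h z ^ n" for z n
    by (induction n) (simp_all add: mult, simp add: h_def)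
  have sc: "h (r *\<^sub>R z) = r *\<^sub>R h z" for r z
    using h by (simp add: linear_simps)
  have "h (exp z) = exp (h z)" for z
    unfolding exp_def
    by (subst bounded_linear.suminf [OF h])
       (auto simp: pow sc intro: summable_exp_generic)
  from this [of "\<i> * of_real \<theta>"] show ?thesis
    by (simp add: h_def flip: exp_Euler cis_conv_exp add: mult.commute)
qed

lemma quat_exp_i: "exp (- (\<theta> *\<^sub>R quat_i)) = Quat (cos \<theta>) (- sin \<theta>) 0 0"
  using exp_scaleR_imaginary_unit [OF quat_units(1), of "- \<theta>"]
  by (simp add: quat_eq_iff)

lemma quat_exp_j: "exp (- (\<theta> *\<^sub>R quat_j)) = Quat (cos \<theta>) 0 (- sin \<theta>) 0"
  using exp_scaleR_imaginary_unit [OF quat_units(2), of "- \<theta>"]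
  by (simp add: quat_eq_iff)

lemma norm_qcnj [simp]: "norm (qcnj q) = norm q"
  by (simp add: norm_quat)

lemma bounded_linear_qcnj: "bounded_linear qcnj"
  by (rule bounded_linear_intro [where K = 1]) (simp_all add: quat_eq_iff)

lemma measurable_qcnj [measurable]: "qcnj \<in> borel_measurable borel"
  by (intro borel_measurable_continuous_onI linear_continuous_on bounded_linear_qcnj)

section \<open>Continuity of translations in the mean\<close>

lemma borel_integral_translation:
  fixes f :: "'a::euclidean_space \<Rightarrow> 'b::{banach, second_countable_topology}"
  assumes [measurable]: "f \<in> borel_measurable borel"
  shows "(LINT x|lborel. f (x + z)) = (LINT x|lborel. f x)"
  by (subst (2) lborel_distr_plus [of z, symmetric], subst integral_distr) (simp_all add: add.commute)

lemma borel_integrable_translation: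
  fixes f :: "'a::euclidean_space \<Rightarrow> 'b::{banach, second_countable_topology}"
  assumes "integrable lborel f"
  shows "integrable lborel (\<lambda>x. f (x + z))"
proof -
  have [measurable]: "f \<in> borel_measurable borel"
    using borel_measurable_integrable [OF assms] by simp
  have "integrable (distr lborel borel ((+) z)) f"
    using assms by (simp add: lborel_distr_plus)
  thus ?thesis
    by (subst (asm) integrable_distr_eq) (simp_all add: add.commute)
qed

lemma integrable_translation_diff:
  fixes f :: "'a::euclidean_space \<Rightarrow> 'b::{banach, second_countable_topology}"
  assumes "integrable lborel f"
  shows "integrable lborel (\<lambda>x. norm (f (x + z) - f x))"
  by (intro integrable_norm Bochner_Integration.integrable_diff borel_integrable_translation assms)

text \<open>For indicators, \<open>\<bar>a - b\<bar> = a + b - 2 * a * b\<close>, so only the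
  overlap of \<open>U\<close> with its translate matters. Openness gives pointwise convergence of
  the overlap at points of \<open>U\<close>; elsewhere it is 0, and \<open>indicat_real U\<close>
  dominates.\<close>

lemma L1_translation_open:
  fixes U :: "'a::euclidean_space set"
  assumes U: "open U" and fU: "emeasure lborel U < \<infinity>"
  shows "((\<lambda>z. LINT x|lborel. \<bar>indicat_real U (x + z) - indicat_real U x\<bar>) \<longlongrightarrow> 0) (at 0)"
  unfolding tendsto_at_iff_sequentially
proof (intro allI impI)
  fix Z :: "nat \<Rightarrow> 'a" assume Z: "Z \<longlonglongrightarrow> 0"
  have [measurable]: "U \<in> sets borel" using U by simp
  have int: "integrable lborel (indicat_real U)"
    using fU by (intro integrable_real_indicator) auto
  note intz = borel_integrable_translation [OF int]
  have intB: "integrable lborel (\<lambda>x. indicat_real U (x + z) * indicat_real U x)" for z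
    by (rule Bochner_Integration.integrable_bound [OF int]) (auto simp: indicator_def)
  have eq: "(LINT x|lborel. \<bar>indicat_real U (x + z) - indicat_real U x\<bar>) =
      2 * (measure lborel U - (LINT x|lborel. indicat_real U (x + z) * indicat_real U x))" for z
  proof -
    have "(LINT x|lborel. \<bar>indicat_real U (x + z) - indicat_real U x\<bar>)
        = (LINT x|lborel. indicat_real U (x + z) + indicat_real U x
            - 2 * (indicat_real U (x + z) * indicat_real U x))"
      by (intro Bochner_Integration.integral_cong) (auto simp: indicator_def)
    also have "\<dots> = (LINT x|lborel. indicat_real U (x + z)) + measure lborel U
        - 2 * (LINT x|lborel. indicat_real U (x + z) * indicat_real U x)"
      using int intz intB by simp
    also have "(LINT x|lborel. indicat_real U (x + z)) = measure lborel U"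
      by (subst borel_integral_translation) auto
    finally show ?thesis by simp
  qed
  have "(\<lambda>n. LINT x|lborel. indicat_real U (x + Z n) * indicat_real U x)
      \<longlonglongrightarrow> (LINT x|lborel. indicat_real U x)"
  proof (rule integral_dominated_convergence [where w = "indicat_real U"])
    show "AE x in lborel. (\<lambda>n. indicat_real U (x + Z n) * indicat_real U x) \<longlonglongrightarrow> indicat_real U x"
    proof (intro AE_I2)
      fix x
      show "(\<lambda>n. indicat_real U (x + Z n) * indicat_real U x) \<longlonglongrightarrow> indicat_real U x"
      proof (cases "x \<in> U")
        case True
        have "(\<lambda>n. x + Z n) \<longlonglongrightarrow> x" using tendsto_add [OF tendsto_const Z, of x] by simp
        hence "\<forall>\<^sub>F n in sequentially. x + Z n \<in> U"
          using topological_tendstoD U True by blast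
        hence "\<forall>\<^sub>F n in sequentially. indicat_real U (x + Z n) * indicat_real U x = indicat_real U x"
          by eventually_elim (simp add: True)
        thus ?thesis by (rule tendsto_eventually)
      qed simp
    qed
  qed (use int in \<open>auto simp: indicator_def\<close>)
  hence "(\<lambda>n. 2 * (measure lborel U - (LINT x|lborel. indicat_real U (x + Z n) * indicat_real U x)))
      \<longlonglongrightarrow> 2 * (measure lborel U - measure lborel U)"
    by (intro tendsto_intros) simp
  thus "((\<lambda>z. LINT x|lborel. \<bar>indicat_real U (x + z) - indicat_real U x\<bar>) \<circ> Z) \<longlonglongrightarrow> 0"
    unfolding eq comp_def by simp
qed

text \<open>An \<open>e / 3\<close> argument: translation preserves the integral, so the error of
  the approximation \<open>s\<close> enters twice, once shifted and once unshifted, and the modulus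
  of \<open>s\<close> once.\<close>

lemma L1_translation_limit:
  fixes f :: "'a::euclidean_space \<Rightarrow> 'b::{banach, second_countable_topology}"
  assumes f: "integrable lborel f"
    and approx: "\<And>e. e > 0 \<Longrightarrow> \<exists>s. integrable lborel s \<and> (LINT x|lborel. norm (s x - f x)) < e \<and>
      ((\<lambda>z. LINT x|lborel. norm (s (x + z) - s x)) \<longlongrightarrow> 0) (at 0)"
  shows "((\<lambda>z. LINT x|lborel. norm (f (x + z) - f x)) \<longlongrightarrow> 0) (at 0)"
proof (rule tendstoI)
  fix e :: real assume e: "e > 0"
  obtain s where s: "integrable lborel s" "(LINT x|lborel. norm (s x - f x)) < e / 3"
      "((\<lambda>z. LINT x|lborel. norm (s (x + z) - s x)) \<longlongrightarrow> 0) (at 0)"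
    using approx [of "e / 3"] e by auto
  have [measurable]: "f \<in> borel_measurable borel" "s \<in> borel_measurable borel"
    using borel_measurable_integrable [OF f] borel_measurable_integrable [OF s(1)] by simp_all
  have d: "integrable lborel (\<lambda>x. norm (s x - f x))"
    using s(1) f by (intro integrable_norm Bochner_Integration.integrable_diff)
  note dz = borel_integrable_translation [OF d]
  have "\<forall>\<^sub>F z in at 0. (LINT x|lborel. norm (s (x + z) - s x)) < e / 3"
    using order_tendstoD(2) [OF s(3), of "e / 3"] e by simp
  thus "\<forall>\<^sub>F z in at 0. dist (LINT x|lborel. norm (f (x + z) - f x)) 0 < e"
  proof eventually_elim
    case (elim z)
    have tr: "norm (f (x + z) - f x) \<le>
        norm (s (x + z) - f (x + z)) + (norm (s (x + z) - s x) + norm (s x - f x))" for x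
      by norm
    have "(LINT x|lborel. norm (f (x + z) - f x)) \<le> (LINT x|lborel.
        norm (s (x + z) - f (x + z)) + (norm (s (x + z) - s x) + norm (s x - f x)))"
      by (intro integral_mono tr Bochner_Integration.integrable_add integrable_translation_diff d dz f s)
    also have "\<dots> = (LINT x|lborel. norm (s (x + z) - f (x + z))) +
        ((LINT x|lborel. norm (s (x + z) - s x)) + (LINT x|lborel. norm (s x - f x)))"
      by (subst Bochner_Integration.integral_add Bochner_Integration.integral_add [OF dz],
          intro Bochner_Integration.integrable_add integrable_translation_diff d dz s)
         (simp add: Bochner_Integration.integral_add [OF integrable_translation_diff [OF s(1)] d])
    also have "(LINT x|lborel. norm (s (x + z) - f (x + z))) = (LINT x|lborel. norm (s x - f x))"
      by (rule borel_integral_translation) simp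
    finally show ?case using s(2) elim by (simp add: integral_nonneg_AE)
  qed
qed

text \<open>Outer regularity of Lebesgue measure approximates \<open>A\<close> in mean by open
  supersets, for which the claim is known.\<close>

lemma L1_translation_indicator:
  fixes A :: "'a::euclidean_space set"
  assumes A [measurable]: "A \<in> sets borel" and fA: "emeasure lborel A < \<infinity>"
  shows "((\<lambda>z. LINT x|lborel. norm (indicat_real A (x + z) - indicat_real A x)) \<longlongrightarrow> 0) (at 0)"
proof (rule L1_translation_limit)
  show intA: "integrable lborel (indicat_real A)"
    using fA by (intro integrable_real_indicator) auto
  fix e :: real assume e: "e > 0"
  obtain U where U: "open U" "A \<subseteq> U" "emeasure lborel (U - A) < e"
    using outer_regular_lborel [OF A e] by metis
  have [measurable]: "U \<in> sets borel" using U by simp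
  have "emeasure lborel U = emeasure lborel A + emeasure lborel (U - A)"
    using U by (subst plus_emeasure) (auto intro!: arg_cong2 [where f = emeasure])
  also have "\<dots> < \<infinity>" using fA U(3) by (auto simp: less_top [symmetric])
  finally have fU: "emeasure lborel U < \<infinity>" .
  have "(LINT x|lborel. norm (indicat_real U x - indicat_real A x)) = (LINT x|lborel. indicat_real (U - A) x)"
    using U(2) by (intro Bochner_Integration.integral_cong) (auto simp: indicator_def)
  also have "\<dots> < e"
    using U(3) e by (cases "emeasure lborel (U - A)") (auto simp: measure_def ennreal_less_iff)
  finally show "\<exists>s. integrable lborel s \<and> (LINT x|lborel. norm (s x - indicat_real A x)) < e \<and>
      ((\<lambda>z. LINT x|lborel. norm (s (x + z) - s x)) \<longlongrightarrow> 0) (at 0)"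
    using fU L1_translation_open [OF U(1) fU]
    by (intro exI [of _ "indicat_real U"] conjI integrable_real_indicator) auto
qed

text \<open>Induction along the construction of integrable functions: multiples of indicators, sums,
  and dominated pointwise limits, the last again by approximation in mean.\<close>

proposition L1_translation_continuous:
  fixes f :: "'a::euclidean_space \<Rightarrow> 'b::{banach, second_countable_topology}"
  assumes "integrable lborel f"
  shows "((\<lambda>z. LINT x|lborel. norm (f (x + z) - f x)) \<longlongrightarrow> 0) (at 0)"
  using assms
proof (induction rule: integrable_induct)
  case (base A c)
  have eq: "(LINT x|lborel. norm (indicator A (x + z) *\<^sub>R c - indicator A x *\<^sub>R c))
      = norm c * (LINT x|lborel. \<bar>indicat_real A (x + z) - indicat_real A x\<bar>)" for z
    by (simp add: mult.commute flip: scaleR_left_diff_distrib)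
  have "((\<lambda>z. LINT x|lborel. \<bar>indicat_real A (x + z) - indicat_real A x\<bar>) \<longlongrightarrow> 0) (at 0)"
    using L1_translation_indicator [of A] base by simp
  thus ?case unfolding eq by (intro tendsto_mult_right_zero)
next
  case (add f g)
  show ?case
  proof (rule tendsto_sandwich [OF _ _ tendsto_const tendsto_add [OF add.IH, simplified]])
    show "\<forall>\<^sub>F z in at 0. (LINT x|lborel. norm (f (x + z) + g (x + z) - (f x + g x))) \<le>
        (LINT x|lborel. norm (f (x + z) - f x)) + (LINT x|lborel. norm (g (x + z) - g x))"
    proof (intro always_eventually allI)
      fix z
      have "(LINT x|lborel. norm (f (x + z) + g (x + z) - (f x + g x))) \<le>
          (LINT x|lborel. norm (f (x + z) - f x) + norm (g (x + z) - g x))"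
        using add.hyps
        by (intro integral_mono norm_diff_triangle_ineq Bochner_Integration.integrable_add
            integrable_translation_diff [of "\<lambda>x. f x + g x"] integrable_translation_diff)
      also have "\<dots> = (LINT x|lborel. norm (f (x + z) - f x)) + (LINT x|lborel. norm (g (x + z) - g x))"
        using add.hyps by (intro Bochner_Integration.integral_add integrable_translation_diff)
      finally show "(LINT x|lborel. norm (f (x + z) + g (x + z) - (f x + g x))) \<le>
        (LINT x|lborel. norm (f (x + z) - f x)) + (LINT x|lborel. norm (g (x + z) - g x))" .
    qed
  qed (simp add: integral_nonneg_AE)
next
  case (lim f s)
  have [measurable]: "f \<in> borel_measurable borel" "\<And>i. s i \<in> borel_measurable borel"
    using borel_measurable_integrable [OF lim(4)] borel_measurable_integrable [OF lim(1)] by simp_all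
  have "(\<lambda>i. LINT x|lborel. norm (s i x - f x)) \<longlonglongrightarrow> (LINT (x::'a)|lborel. 0)"
  \<comment> \<open>The induction provides \<open>norm (s i x) \<le> 2 * norm (f x)\<close>; the
    triangle inequality adds one more \<open>norm (f x)\<close>.\<close>
  proof (rule integral_dominated_convergence [where w = "\<lambda>x. 3 * norm (f x)"])
    show "AE x in lborel. (\<lambda>i. norm (s i x - f x)) \<longlonglongrightarrow> 0"
      using lim(2) by (auto intro!: AE_I2 tendsto_norm_zero simp: LIM_zero_iff)
    show "AE x in lborel. norm (norm (s i x - f x)) \<le> 3 * norm (f x)" for i
    proof (intro AE_I2)
      fix x
      show "norm (norm (s i x - f x)) \<le> 3 * norm (f x)"
        using lim(3) [of x i] norm_triangle_ineq4 [of "s i x" "f x"] by simp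
    qed
  qed (use lim in auto)
  hence conv: "(\<lambda>i. LINT x|lborel. norm (s i x - f x)) \<longlonglongrightarrow> 0" by simp
  show ?case
  proof (rule L1_translation_limit)
    fix e :: real assume "e > 0"
    hence "\<forall>\<^sub>F i in sequentially. (LINT x|lborel. norm (s i x - f x)) < e"
      by (rule order_tendstoD(2) [OF conv])
    then obtain i where "(LINT x|lborel. norm (s i x - f x)) < e"
      by (auto simp: eventually_sequentially)
    thus "\<exists>s. integrable lborel s \<and> (LINT x|lborel. norm (s x - f x)) < e \<and>
        ((\<lambda>z. LINT x|lborel. norm (s (x + z) - s x)) \<longlongrightarrow> 0) (at 0)"
      using lim by (intro exI [of _ "s i"]) simp
  qed (use lim in simp)
qed

text \<open>Transfers continuity of translations from \<open>L\<^sup>1\<close> to \<open>L\<^sup>2\<close>: if \<open>u\<close> is square integrable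
  then \<open>norm u *\<^sub>R u\<close> is integrable.\<close>
lemma norm_diff_square_le:
  fixes a b :: "'a::real_inner"
  shows "(norm (a - b))\<^sup>2 \<le> 2 * norm (norm a *\<^sub>R a - norm b *\<^sub>R b)"
proof (cases "a = b")
  case False
  let ?s = "norm a + norm b" and ?d = "norm (a - b)"
  \<comment> \<open>The extra square completes the left side to an exact identity: multiplied out,
    both sides are \<open>2 * (norm a ^ 3 + norm b ^ 3 - ?s * inner a b)\<close>.\<close>
  have "?s * ?d\<^sup>2 \<le> ?s * (?d\<^sup>2 + (norm a - norm b)\<^sup>2)"
    by (intro mult_left_mono) auto
  also have "\<dots> = 2 * inner (norm a *\<^sub>R a - norm b *\<^sub>R b) (a - b)"
    by (simp add: power2_norm_eq_inner [of "a - b"] inner_diff inner_commute [of b a])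
       (simp add: algebra_simps power2_eq_square flip: power2_norm_eq_inner)
  also have "\<dots> \<le> 2 * (norm (norm a *\<^sub>R a - norm b *\<^sub>R b) * ?d)"
    by (intro mult_left_mono norm_cauchy_schwarz) auto
  finally have *: "?s * ?d\<^sup>2 \<le> 2 * norm (norm a *\<^sub>R a - norm b *\<^sub>R b) * ?d" by simp
  have "?d * ?d\<^sup>2 \<le> ?s * ?d\<^sup>2"
    by (intro mult_right_mono norm_triangle_ineq4) auto
  with * have "?d * ?d\<^sup>2 \<le> ?d * (2 * norm (norm a *\<^sub>R a - norm b *\<^sub>R b))" by (simp add: mult_ac)
  thus ?thesis
    by (rule mult_left_le_imp_le) (use False in simp)
qed simp

section \<open>Autocorrelation of a square-integrable function\<close>

lemma integrable_inner_L2: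
  fixes f g :: "'a \<Rightarrow> 'b::euclidean_space"
  assumes [measurable]: "f \<in> borel_measurable M" "g \<in> borel_measurable M"
    and "integrable M (\<lambda>x. (norm (f x))\<^sup>2)" "integrable M (\<lambda>x. (norm (g x))\<^sup>2)"
  shows "integrable M (\<lambda>x. inner (f x) (g x))"
proof (rule Bochner_Integration.integrable_bound)
  show "integrable M (\<lambda>x. ((norm (f x))\<^sup>2 + (norm (g x))\<^sup>2) / 2)"
    using assms by simp
  show "AE x in M. norm (inner (f x) (g x)) \<le> norm (((norm (f x))\<^sup>2 + (norm (g x))\<^sup>2) / 2)"
  proof (intro AE_I2)
    fix x
    show "norm (inner (f x) (g x)) \<le> norm (((norm (f x))\<^sup>2 + (norm (g x))\<^sup>2) / 2)"
      using Cauchy_Schwarz_ineq2 [of "f x" "g x"] sum_squares_bound [of "norm (f x)" "norm (g x)"]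
      by simp
  qed
qed simp

text \<open>The dimension is left open because the locale serves twice: for functions on the plane
  in the Plancherel inequality, and for \<open>\<Phi>\<close> on the product of two planes.\<close>

locale L2_function =
  fixes u :: "'a::euclidean_space \<Rightarrow> 'b::euclidean_space"
  assumes meas [measurable]: "u \<in> borel_measurable borel"
    and sq_int: "integrable lborel (\<lambda>x. (norm (u x))\<^sup>2)"
begin

definition autocorr :: "'a \<Rightarrow> real" where
  "autocorr z = (LINT x|lborel. inner (u x) (u (x + z)))"

lemma sq_int_translation: "integrable lborel (\<lambda>x. (norm (u (x + z)))\<^sup>2)"
  by (rule borel_integrable_translation [OF sq_int])

lemma integrable_inner_translation: "integrable lborel (\<lambda>x. inner (u (x + y)) (u (x + z)))"
  by (rule integrable_inner_L2) (auto intro: sq_int_translation)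

lemma integrable_sq_diff: "integrable lborel (\<lambda>x. (norm (u (x + y) - u (x + z)))\<^sup>2)"
proof -
  have "integrable lborel (\<lambda>x. (norm (u (x + y)))\<^sup>2 + (norm (u (x + z)))\<^sup>2
      - 2 * inner (u (x + y)) (u (x + z)))"
    by (intro Bochner_Integration.integrable_add Bochner_Integration.integrable_diff
        sq_int_translation integrable_mult_right integrable_inner_translation)
  thus ?thesis
    by (simp add: power2_norm_eq_inner inner_diff inner_commute algebra_simps)
qed

lemma autocorr_shift:
  "(LINT x|lborel. inner (u (x + y)) (u (x + z))) = autocorr (z - y)"
  unfolding autocorr_def
  using borel_integral_translation [of "\<lambda>x. inner (u x) (u (x + (z - y)))" y] by (simp add: add.assoc)

lemma autocorr_0: "autocorr 0 = (LINT x|lborel. (norm (u x))\<^sup>2)"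
  by (simp add: autocorr_def power2_norm_eq_inner)

lemma integral_sq_diff:
  "(LINT x|lborel. (norm (u (x + y) - u (x + z)))\<^sup>2) = 2 * (autocorr 0 - autocorr (z - y))"
proof -
  have "(LINT x|lborel. (norm (u (x + y) - u (x + z)))\<^sup>2) =
      (LINT x|lborel. (norm (u (x + y)))\<^sup>2 + (norm (u (x + z)))\<^sup>2 - 2 * inner (u (x + y)) (u (x + z)))"
    by (simp add: power2_norm_eq_inner inner_diff inner_commute algebra_simps)
  also have "\<dots> = autocorr 0 + autocorr 0 - 2 * autocorr (z - y)"
    using borel_integral_translation [of "\<lambda>x. (norm (u x))\<^sup>2"]
    by (simp add: sq_int_translation integrable_inner_translation autocorr_shift autocorr_0)
  finally show ?thesis by simp
qed

lemma autocorr_le: "\<bar>autocorr z\<bar> \<le> autocorr 0"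
proof -
  have "\<bar>inner (u x) (u (x + z))\<bar> \<le> ((norm (u x))\<^sup>2 + (norm (u (x + z)))\<^sup>2) / 2" for x
    using Cauchy_Schwarz_ineq2 [of "u x" "u (x + z)"] sum_squares_bound [of "norm (u x)" "norm (u (x + z))"]
    by simp
  hence "\<bar>autocorr z\<bar> \<le> (LINT x|lborel. ((norm (u x))\<^sup>2 + (norm (u (x + z)))\<^sup>2) / 2)"
    unfolding autocorr_def using integrable_inner_translation [of 0 z] sq_int sq_int_translation [of z]
    by (intro order.trans [OF integral_abs_bound] integral_mono) auto
  also have "\<dots> = autocorr 0"
    using borel_integral_translation [of "\<lambda>x. (norm (u x))\<^sup>2" z]
    by (simp add: sq_int sq_int_translation autocorr_0)
  finally show ?thesis .
qed

lemma autocorr_measurable [measurable]: "autocorr \<in> borel_measurable borel"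
  unfolding autocorr_def by measurable

text \<open>By polarization, \<open>2 * (autocorr 0 - autocorr z)\<close> is the squared distance
  between \<open>u\<close> and its translate. The inequality \<open>norm_diff_square_le\<close>
  bounds it by the mean modulus of continuity of the integrable function
  \<open>norm u *\<^sub>R u\<close>; \<open>autocorr_le\<close> gives the other half of the
  squeeze.\<close>

lemma autocorr_tendsto: "(autocorr \<longlongrightarrow> autocorr 0) (at 0)"
proof -
  let ?v = "\<lambda>x. norm (u x) *\<^sub>R u x"
  have v: "integrable lborel ?v"
    by (rule Bochner_Integration.integrable_bound [OF sq_int]) (auto simp: power2_eq_square)
  have le: "autocorr 0 - (LINT x|lborel. norm (?v (x + z) - ?v x)) \<le> autocorr z" for z
  proof -
    have "2 * (autocorr 0 - autocorr z) = (LINT x|lborel. (norm (u (x + z) - u x))\<^sup>2)"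
      using integral_sq_diff [of 0 z] by (simp add: norm_minus_commute)
    also have "\<dots> \<le> (LINT x|lborel. 2 * norm (?v (x + z) - ?v x))"
      using integrable_sq_diff [of z 0]
      by (intro integral_mono norm_diff_square_le integrable_mult_right integrable_translation_diff v) simp
    finally show ?thesis by simp
  qed
  have "((\<lambda>z. autocorr 0 - (LINT x|lborel. norm (?v (x + z) - ?v x))) \<longlongrightarrow> autocorr 0 - 0) (at 0)"
    by (intro tendsto_intros L1_translation_continuous v)
  thus ?thesis
    by (intro tendsto_sandwich [of "\<lambda>z. autocorr 0 - (LINT x|lborel. norm (?v (x + z) - ?v x))"
        autocorr "at 0" "\<lambda>_. autocorr 0"])
       (use le autocorr_le in \<open>auto intro!: always_eventually dest: abs_le_D1\<close>)
qed

end

section \<open>The standard Gaussian measure on the plane\<close>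

text \<open>Identifies pairs of reals with vectors, so that product measures can be pushed forward
  to \<open>real^2\<close>.\<close>

definition plane_vec :: "real \<times> real \<Rightarrow> real^2" where
  "plane_vec p = fst p *\<^sub>R axis 1 1 + snd p *\<^sub>R axis 2 1"

lemma plane_vec_nth [simp]: "plane_vec p $ 1 = fst p" "plane_vec p $ 2 = snd p"
  by (simp_all add: plane_vec_def axis_def)

lemma measurable_plane_vec [measurable]: "plane_vec \<in> borel \<rightarrow>\<^sub>M borel"
  unfolding plane_vec_def borel_prod [symmetric] by measurable

lemma lborel_plane: "distr lborel borel plane_vec = lborel"
proof (rule lborel_eqI [symmetric])
  fix l u :: "real^2"
  assume lu: "\<And>b. b \<in> Basis \<Longrightarrow> inner l b \<le> inner u b"
  have comp: "l $ i \<le> u $ i" for i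
    using lu [of "axis i 1"] by (simp add: inner_axis)
  have "plane_vec -` box l u = box (l$1, l$2) (u$1, u$2)"
    by (auto simp: box_def Basis_vec_def inner_axis Basis_prod_def forall_2)
  hence "emeasure (distr lborel borel plane_vec) (box l u) =
      emeasure lborel (box (l$1, l$2) (u$1, u$2))"
    by (simp add: emeasure_distr)
  also have "\<dots> = ennreal ((u$1 - l$1) * (u$2 - l$2))"
    using comp by (subst emeasure_lborel_box_eq)
      (auto simp: Basis_prod_def prod.union_disjoint)
  also have "(u$1 - l$1) * (u$2 - l$2) = (\<Prod>b\<in>Basis. inner (u - l) b)"
    by (subst Basis_vec_def) (simp add: prod.UNION_disjoint UNIV_2 inner_axis axis_eq_axis)
  finally show "emeasure (distr lborel borel plane_vec) (box l u) = (\<Prod>b\<in>Basis. inner (u - l) b)" .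
qed simp

text \<open>The pushforward form makes integrals of products of coordinate functions factor; the
  density form is recovered in \<open>gauss_plane_density\<close>.\<close>

definition gauss_plane :: "(real^2) measure" where
  "gauss_plane = distr (std_normal_distribution \<Otimes>\<^sub>M std_normal_distribution) borel plane_vec"

lemma sets_gauss_plane [simp, measurable_cong]: "sets gauss_plane = sets borel"
  by (simp add: gauss_plane_def)

interpretation std_normal: prob_space std_normal_distribution
  by (rule prob_space_normal_density) simp

interpretation std_normal_pair: pair_prob_space std_normal_distribution std_normal_distribution ..

lemma sets_std_normal_pair [simp, measurable_cong]:
  "sets (std_normal_distribution \<Otimes>\<^sub>M std_normal_distribution) = sets (borel :: (real \<times> real) measure)"
  by (subst borel_prod [symmetric], intro sets_pair_measure_cong) simp_all

interpretation gauss_plane: prob_space gauss_plane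
  unfolding gauss_plane_def by (rule std_normal_pair.prob_space_distr) simp

lemma gauss_plane_density:
  "gauss_plane = density lborel (\<lambda>z. ennreal (exp (- (norm z)\<^sup>2 / 2) / (2 * pi)))"
proof -
  have "std_normal_distribution \<Otimes>\<^sub>M std_normal_distribution =
      density (lborel \<Otimes>\<^sub>M lborel) (\<lambda>(x, y). ennreal (std_normal_density x) * ennreal (std_normal_density y))"
    by (intro pair_measure_density sigma_finite_lborel)
       (auto intro: prob_space_imp_sigma_finite std_normal.prob_space_axioms)
  also have "(\<lambda>(x, y). ennreal (std_normal_density x) * ennreal (std_normal_density y)) =
      (\<lambda>p. ennreal (exp (- (norm (plane_vec p))\<^sup>2 / 2) / (2 * pi)))"
    by (auto simp: fun_eq_iff std_normal_density_def norm_vec_def L2_set_def UNIV_2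
        diff_divide_distrib simp flip: ennreal_mult exp_add)
  finally have eq: "gauss_plane =
      distr (density lborel (\<lambda>p. ennreal (exp (- (norm (plane_vec p))\<^sup>2 / 2) / (2 * pi)))) borel plane_vec"
    by (simp add: gauss_plane_def lborel_prod)
  have "density lborel (\<lambda>z. ennreal (exp (- (norm z)\<^sup>2 / 2) / (2 * pi))) =
      density (distr lborel borel plane_vec) (\<lambda>z. ennreal (exp (- (norm z)\<^sup>2 / 2) / (2 * pi)))"
    by (simp add: lborel_plane)
  also have "\<dots> = gauss_plane"
    unfolding eq by (rule density_distr) simp_all
  finally show ?thesis ..
qed

text \<open>Real and imaginary parts of the characteristic function of the standard normal
  law.\<close>

lemma std_normal_cos_sin:
  "(LINT x|std_normal_distribution. cos (t * x)) = exp (- t\<^sup>2 / 2)"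
  "(LINT x|std_normal_distribution. sin (t * x)) = 0"
proof -
  have int: "complex_integrable std_normal_distribution (\<lambda>x. iexp (t * x))"
    by (rule std_normal.integrable_iexp) auto
  have *: "(CLINT x|std_normal_distribution. iexp (t * x)) = of_real (exp (- t\<^sup>2 / 2))"
    using char_std_normal_distribution by (simp add: char_def fun_eq_iff)
  have "(LINT x|std_normal_distribution. cos (t * x)) = Re (CLINT x|std_normal_distribution. iexp (t * x))"
    by (subst integral_Re [OF int, symmetric]) (simp add: Re_exp)
  thus "(LINT x|std_normal_distribution. cos (t * x)) = exp (- t\<^sup>2 / 2)" unfolding * by simp
  have "(LINT x|std_normal_distribution. sin (t * x)) = Im (CLINT x|std_normal_distribution. iexp (t * x))"
    by (subst integral_Im [OF int, symmetric]) (simp add: Im_exp)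
  thus "(LINT x|std_normal_distribution. sin (t * x)) = 0" unfolding * by simp
qed

lemma gauss_plane_integral_prod:
  fixes g h :: "real \<Rightarrow> real"
  assumes [measurable]: "g \<in> borel_measurable borel" "h \<in> borel_measurable borel"
    and "\<And>x. \<bar>g x\<bar> \<le> 1" "\<And>x. \<bar>h x\<bar> \<le> 1"
  shows "(LINT z|gauss_plane. g (z$1) * h (z$2)) =
    (LINT x|std_normal_distribution. g x) * (LINT x|std_normal_distribution. h x)"
proof -
  have [measurable]: "(\<lambda>z::real^2. z $ i) \<in> borel_measurable borel" for i
    by (intro borel_measurable_continuous_onI continuous_intros)
  have [measurable]: "(\<lambda>p. g (fst p) * h (snd p)) \<in> borel_measurable borel"
    unfolding borel_prod [symmetric] by measurable
  have int: "integrable (std_normal_distribution \<Otimes>\<^sub>M std_normal_distribution) (\<lambda>p. g (fst p) * h (snd p))"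
    using assms
    by (intro std_normal_pair.integrable_const_bound [where B = 1])
       (auto simp: abs_mult intro!: mult_le_one)
  have "(LINT z|gauss_plane. g (z$1) * h (z$2)) =
      (LINT p|(std_normal_distribution \<Otimes>\<^sub>M std_normal_distribution). g (fst p) * h (snd p))"
    unfolding gauss_plane_def by (subst integral_distr) simp_all
  also have "\<dots> = (LINT x|std_normal_distribution. LINT y|std_normal_distribution. g x * h y)"
    using std_normal_pair.integral_fst' [OF int] by simp
  also have "\<dots> = (LINT x|std_normal_distribution. g x) * (LINT x|std_normal_distribution. h x)"
    by simp
  finally show ?thesis .
qed

section \<open>A Plancherel inequality for the two-sided Fourier transform\<close>

lemma nn_integral_scaleR:
  fixes f :: "'a::euclidean_space \<Rightarrow> ennreal"
  assumes [measurable]: "f \<in> borel_measurable borel" and c: "c > 0"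
  shows "(\<integral>\<^sup>+ x. f x \<partial>lborel) = ennreal (c ^ DIM('a)) * (\<integral>\<^sup>+ x. f (c *\<^sub>R x) \<partial>lborel)"
  using c by (subst lborel_affine [of c 0])
    (simp_all add: nn_integral_density nn_integral_distr nn_integral_cmult)

lemma integral_scaleR:
  fixes f :: "'a::euclidean_space \<Rightarrow> real"
  assumes [measurable]: "f \<in> borel_measurable borel" and c: "c > 0"
  shows "(LINT x|lborel. f x) = c ^ DIM('a) * (LINT x|lborel. f (c *\<^sub>R x))"
  using c by (subst lborel_affine [of c 0])
    (simp_all add: integral_density integral_distr)

text \<open>The two-sided Fourier kernel as an action of the phases \<open>a\<close> and
  \<open>b\<close> on quaternions. Left and right multiplications commute, so this is a
  two-parameter group of isometries, which stands in for commutativity of the kernel.\<close>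

definition qker :: "real \<Rightarrow> real \<Rightarrow> quat \<Rightarrow> quat" where
  "qker a b q = exp (- (a *\<^sub>R quat_i)) * q * exp (- (b *\<^sub>R quat_j))"

lemma norm_qker [simp]: "norm (qker a b q) = norm q"
  by (simp add: qker_def norm_mult quat_exp_i quat_exp_j, simp add: norm_quat)

lemma qker_expand:
  "qker a b q = (cos a * cos b) *\<^sub>R q - (sin a * cos b) *\<^sub>R (quat_i * q)
     - (cos a * sin b) *\<^sub>R (q * quat_j) + (sin a * sin b) *\<^sub>R (quat_i * q * quat_j)"
  by (simp add: qker_def quat_exp_i quat_exp_j quat_eq_iff algebra_simps)

text \<open>Multiplication by a unit quaternion on either side is orthogonal, so the phases of
  \<open>q\<close> move over to \<open>p\<close> with opposite sign and only differences
  remain.\<close>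

lemma inner_qker_shift: "inner (qker a b p) (qker a' b' q) = inner (qker (a - a') (b - b') p) q"
  unfolding qker_def quat_exp_i quat_exp_j inner_quat cos_diff sin_diff quat_ring_sel quat.sel
  by algebra

lemma inner_qker:
  "inner (qker a b p) (qker a' b' q) =
     cos (a - a') * cos (b - b') * inner p q
     - sin (a - a') * cos (b - b') * inner (quat_i * p) q
     - cos (a - a') * sin (b - b') * inner (p * quat_j) q
     + sin (a - a') * sin (b - b') * inner (quat_i * p * quat_j) q"
  unfolding inner_qker_shift qker_expand [of "a - a'"] by (simp only: inner_simps)

lemma measurable_qker [measurable (raw)]:
  assumes [measurable]: "f \<in> borel_measurable M" "g \<in> borel_measurable M" "h \<in> borel_measurable M"
  shows "(\<lambda>x. qker (f x) (g x) (h x)) \<in> borel_measurable M"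
  unfolding qker_expand by measurable

lemma measurable_vec_nth [measurable (raw)]:
  assumes "f \<in> M \<rightarrow>\<^sub>M borel"
  shows "(\<lambda>x. (f x :: real^'n) $ i) \<in> borel_measurable M"
  using assms by (rule measurable_compose)
    (intro borel_measurable_continuous_onI continuous_intros)

definition qft :: "(real^2 \<Rightarrow> quat) \<Rightarrow> real^2 \<Rightarrow> quat" where
  "qft u \<omega> = (LINT x|lborel. qker (2 * pi * x$1 * \<omega>$1) (2 * pi * x$2 * \<omega>$2) (u x))"

lemma measurable_qft [measurable]:
  assumes [measurable]: "u \<in> borel_measurable borel"
  shows "qft u \<in> borel_measurable borel"
  unfolding qft_def by measurable

lemma integrable_qker:
  assumes "integrable lborel u"
  shows "integrable lborel (\<lambda>x::real^2. qker (a * x$1) (b * x$2) (u x))"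
proof -
  have [measurable]: "u \<in> borel_measurable borel"
    using borel_measurable_integrable [OF assms] by simp
  show ?thesis
    by (rule Bochner_Integration.integrable_bound [OF assms]) auto
qed

lemma norm_square_plane: "(norm (v :: real^2))\<^sup>2 = (v$1)\<^sup>2 + (v$2)\<^sup>2"
  by (simp add: norm_vec_def L2_set_def UNIV_2)

text \<open>Of the four terms in \<open>inner_qker\<close> only the one with two cosines survives
  averaging, since the Gaussian mean of each sine is 0. The non-commutative terms thus disappear, as
  in the complex case.\<close>

lemma gauss_plane_integral_inner_qker:
  fixes x y :: "real^2"
  assumes "\<sigma> > 0"
  shows "(LINT z|gauss_plane. inner (qker (x$1 * z$1 / \<sigma>) (x$2 * z$2 / \<sigma>) p) (qker (y$1 * z$1 / \<sigma>) (y$2 * z$2 / \<sigma>) q))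
    = exp (- (norm ((y - x) /\<^sub>R \<sigma>))\<^sup>2 / 2) * inner p q"
proof -
  define s t where "s = (x$1 - y$1) / \<sigma>" and "t = (x$2 - y$2) / \<sigma>"
  have st: "x$1 * z$1 / \<sigma> - y$1 * z$1 / \<sigma> = s * z$1" "x$2 * z$2 / \<sigma> - y$2 * z$2 / \<sigma> = t * z$2"
    for z :: "real^2"
    by (simp_all add: s_def t_def diff_divide_distrib algebra_simps)
  have int: "integrable gauss_plane (\<lambda>z. g (s * z$1) * h (t * z$2))"
    if "g \<in> {cos, sin}" "h \<in> {cos, sin}" for g h :: "real \<Rightarrow> real"
  proof -
    have [measurable]: "g \<in> borel_measurable borel" "h \<in> borel_measurable borel"
      using that by auto
    show ?thesis
      using that by (intro gauss_plane.integrable_const_bound [where B = 1])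
        (auto simp: abs_mult intro!: mult_le_one)
  qed
  have "(LINT z|gauss_plane. inner (qker (x$1 * z$1 / \<sigma>) (x$2 * z$2 / \<sigma>) p) (qker (y$1 * z$1 / \<sigma>) (y$2 * z$2 / \<sigma>) q))
    = (LINT z|gauss_plane. cos (s * z$1) * cos (t * z$2)) * inner p q
     - (LINT z|gauss_plane. sin (s * z$1) * cos (t * z$2)) * inner (quat_i * p) q
     - (LINT z|gauss_plane. cos (s * z$1) * sin (t * z$2)) * inner (p * quat_j) q
     + (LINT z|gauss_plane. sin (s * z$1) * sin (t * z$2)) * inner (quat_i * p * quat_j) q"
    unfolding inner_qker st using int by simp
  also have "\<dots> = exp (- s\<^sup>2 / 2) * exp (- t\<^sup>2 / 2) * inner p q"
    by (subst gauss_plane_integral_prod [of "\<lambda>r. cos (s * r)" "\<lambda>r. cos (t * r)"]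
        gauss_plane_integral_prod [of "\<lambda>r. sin (s * r)" "\<lambda>r. cos (t * r)"]
        gauss_plane_integral_prod [of "\<lambda>r. cos (s * r)" "\<lambda>r. sin (t * r)"]
        gauss_plane_integral_prod [of "\<lambda>r. sin (s * r)" "\<lambda>r. sin (t * r)"]; simp add: std_normal_cos_sin)+
  also have "exp (- s\<^sup>2 / 2) * exp (- t\<^sup>2 / 2) = exp (- (norm ((y - x) /\<^sub>R \<sigma>))\<^sup>2 / 2)"
  proof -
    have "((y - x) /\<^sub>R \<sigma>) $ 1 = - s" "((y - x) /\<^sub>R \<sigma>) $ 2 = - t"
      by (simp_all add: s_def t_def divide_inverse algebra_simps)
    hence "(norm ((y - x) /\<^sub>R \<sigma>))\<^sup>2 = s\<^sup>2 + t\<^sup>2"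
      by (simp only: norm_square_plane power2_minus)
    thus ?thesis by (simp add: add_divide_distrib diff_divide_distrib flip: exp_add)
  qed
  finally show ?thesis .
qed

lemma integrable_norm_prod:
  fixes u v :: "'a::euclidean_space \<Rightarrow> 'b::{banach, second_countable_topology}"
  assumes u: "integrable lborel u" and v: "integrable lborel v"
  shows "integrable lborel (\<lambda>p. norm (u (fst p)) * norm (v (snd p)))"
proof -
  have [measurable]: "u \<in> borel_measurable borel" "v \<in> borel_measurable borel"
    using borel_measurable_integrable [OF u] borel_measurable_integrable [OF v] by simp_all
  have "integrable (lborel \<Otimes>\<^sub>M lborel) (\<lambda>p. norm (u (fst p)) * norm (v (snd p)))"
    by (rule lborel_pair.Fubini_integrable) (use u v in \<open>auto simp: abs_mult\<close>)
  thus ?thesis by (simp add: lborel_prod)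
qed

text \<open>The inner product of the integral with itself, expanded by Fubini; the product of norms
  is an integrable majorant.\<close>

lemma norm_integral_square:
  fixes f :: "'a::euclidean_space \<Rightarrow> 'b::euclidean_space"
  assumes f: "integrable lborel f"
  shows "(norm (LINT x|lborel. f x))\<^sup>2 = (LINT p|lborel. inner (f (fst p)) (f (snd p)))"
proof -
  have [measurable]: "f \<in> borel_measurable borel"
    using borel_measurable_integrable [OF f] by simp
  have "integrable (lborel \<Otimes>\<^sub>M lborel) (\<lambda>p. inner (f (fst p)) (f (snd p)))"
    unfolding lborel_prod
  proof (rule Bochner_Integration.integrable_bound [OF integrable_norm_prod [OF f f]])
    show "(\<lambda>p. inner (f (fst p)) (f (snd p))) \<in> borel_measurable lborel"
      unfolding lborel_prod [symmetric] by measurable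
  qed (auto intro: Cauchy_Schwarz_ineq2)
  from lborel_pair.integral_fst' [OF this]
  have "(LINT p|lborel. inner (f (fst p)) (f (snd p))) = (LINT x|lborel. LINT y|lborel. inner (f x) (f y))"
    by (simp add: lborel_prod)
  also have "\<dots> = (norm (LINT x|lborel. f x))\<^sup>2"
    using f by (simp add: power2_norm_eq_inner)
  finally show ?thesis ..
qed

text \<open>Rescaling by \<open>2 * pi * \<sigma>\<close> turns the phases into
  \<open>x$i * z$i / \<sigma>\<close>, whose Gaussian average is known. Fubini applies because the
  Gaussian measure is finite and the kernel is isometric.\<close>

lemma gauss_plane_integral_qft:
  assumes u: "integrable lborel u" and \<sigma>: "\<sigma> > 0"
  shows "(LINT z|gauss_plane. (norm (qft u (z /\<^sub>R (2 * pi * \<sigma>))))\<^sup>2) =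
    (LINT p|lborel. exp (- (norm ((snd p - fst p) /\<^sub>R \<sigma>))\<^sup>2 / 2) * inner (u (fst p)) (u (snd p)))"
proof -
  have [measurable]: "u \<in> borel_measurable borel"
    using borel_measurable_integrable [OF u] by simp
  let ?E = "\<lambda>z x. qker (x$1 * z$1 / \<sigma>) (x$2 * z$2 / \<sigma>) (u x)"
  have qft: "qft u (z /\<^sub>R (2 * pi * \<sigma>)) = (LINT x|lborel. ?E z x)" for z
    unfolding qft_def by (intro Bochner_Integration.integral_cong) (simp_all add: field_simps)
  have E: "integrable lborel (?E z)" for z :: "real^2"
    using integrable_qker [OF u, of "z$1 / \<sigma>" "z$2 / \<sigma>"] by (simp add: mult.commute)
  interpret GP: pair_sigma_finite gauss_plane "lborel :: ((real^2) \<times> (real^2)) measure" ..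
  let ?F = "\<lambda>z p. inner (?E z (fst p)) (?E z (snd p))"
  have [measurable]: "case_prod ?F \<in> borel_measurable (gauss_plane \<Otimes>\<^sub>M lborel)"
    unfolding lborel_prod [symmetric] by measurable
  have int: "integrable (gauss_plane \<Otimes>\<^sub>M lborel) (case_prod ?F)"
  proof (rule Bochner_Integration.integrable_bound)
    have [measurable]: "(\<lambda>p. norm (u (fst p)) * norm (u (snd p))) \<in> borel_measurable lborel"
      unfolding lborel_prod [symmetric] by measurable
    show "integrable (gauss_plane \<Otimes>\<^sub>M lborel) (\<lambda>q. norm (u (fst (snd q))) * norm (u (snd (snd q))))"
    proof (rule GP.Fubini_integrable)
      show "(\<lambda>q. norm (u (fst (snd q))) * norm (u (snd (snd q)))) \<in> borel_measurable (gauss_plane \<Otimes>\<^sub>M lborel)"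
        unfolding lborel_prod [symmetric] by measurable
    qed (use integrable_norm_prod [OF u u] in \<open>auto simp: abs_mult\<close>)
    show "AE q in gauss_plane \<Otimes>\<^sub>M lborel. norm (case_prod ?F q) \<le> norm (norm (u (fst (snd q))) * norm (u (snd (snd q))))"
      by (intro AE_I2) (auto simp: split_beta intro!: order.trans [OF Cauchy_Schwarz_ineq2])
  qed simp
  have "(LINT z|gauss_plane. (norm (qft u (z /\<^sub>R (2 * pi * \<sigma>))))\<^sup>2) = (LINT z|gauss_plane. LINT p|lborel. ?F z p)"
    unfolding qft by (simp add: norm_integral_square [OF E])
  also have "\<dots> = (LINT p|lborel. LINT z|gauss_plane. ?F z p)"
    by (rule GP.Fubini_integral [OF int, symmetric])
  finally show ?thesis
    by (simp add: gauss_plane_integral_inner_qker [OF \<sigma>])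
qed

context L2_function
begin

text \<open>Substitute \<open>y = x + z\<close> and integrate over \<open>x\<close> first: the
  weight depends on \<open>z\<close> alone.\<close>

lemma gauss_plane_autocorr:
  assumes u: "integrable lborel u" and \<sigma>: "\<sigma> > 0"
  shows "(LINT p|lborel. exp (- (norm ((snd p - fst p) /\<^sub>R \<sigma>))\<^sup>2 / 2) * inner (u (fst p)) (u (snd p)))
    = (LINT z|lborel. exp (- (norm (z /\<^sub>R \<sigma>))\<^sup>2 / 2) * autocorr z)"
proof -
  let ?K = "\<lambda>z. exp (- (norm (z /\<^sub>R \<sigma>))\<^sup>2 / 2)"
  let ?G = "\<lambda>x y. ?K (y - x) * inner (u x) (u y)"
  have K: "0 \<le> ?K z" "?K z \<le> 1" for z :: 'a by simp_all
  have int: "integrable (lborel \<Otimes>\<^sub>M lborel) (\<lambda>p. ?G (fst p) (snd p))"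
    unfolding lborel_prod
  proof (rule Bochner_Integration.integrable_bound [OF integrable_norm_prod [OF u u]])
    show "(\<lambda>p. ?G (fst p) (snd p)) \<in> borel_measurable lborel"
      unfolding lborel_prod [symmetric] by measurable
    show "AE p in lborel. norm (?G (fst p) (snd p)) \<le> norm (norm (u (fst p)) * norm (u (snd p)))"
      using mult_mono [OF K(2) Cauchy_Schwarz_ineq2]
      by (intro AE_I2) (simp add: abs_mult)
  qed
  let ?H = "\<lambda>x z. ?K z * inner (u x) (u (x + z))"
  have intH: "integrable (lborel \<Otimes>\<^sub>M lborel) (case_prod ?H)"
  proof (rule lborel_pair.Fubini_integrable)
    have "(\<lambda>x. LINT y|lborel. norm (case_prod ?H (x, y))) = (\<lambda>x. LINT y|lborel. norm (?G x y))"
    proof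
      fix x
      show "(LINT y|lborel. norm (case_prod ?H (x, y))) = (LINT y|lborel. norm (?G x y))"
        using borel_integral_translation [of "\<lambda>y. norm (?G x y)" x] by (simp add: add.commute)
    qed
    thus "integrable lborel (\<lambda>x. LINT y|lborel. norm (case_prod ?H (x, y)))"
      using lborel_pair.integrable_fst' [OF integrable_norm [OF int]] by simp
    show "AE x in lborel. integrable lborel (\<lambda>y. case_prod ?H (x, y))"
      using lborel_pair.AE_integrable_fst' [OF int]
    proof eventually_elim
      case (elim x)
      from borel_integrable_translation [OF this, of x] show ?case by (simp add: add.commute)
    qed
  qed measurable
  have "(LINT p|lborel. ?G (fst p) (snd p)) = (LINT x|lborel. LINT y|lborel. ?G x y)"
    using lborel_pair.integral_fst' [OF int] by (simp add: lborel_prod)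
  also have "\<dots> = (LINT x|lborel. LINT z|lborel. ?H x z)"
  proof (rule Bochner_Integration.integral_cong)
    fix x :: 'a
    show "(LINT y|lborel. ?G x y) = (LINT z|lborel. ?H x z)"
      using borel_integral_translation [of "?G x" x] by (simp add: add.commute)
  qed simp
  also have "\<dots> = (LINT z|lborel. LINT x|lborel. ?H x z)"
    by (rule lborel_pair.Fubini_integral [OF intH, symmetric])
  also have "\<dots> = (LINT z|lborel. ?K z * autocorr z)"
    by (simp add: autocorr_def)
  finally show ?thesis .
qed

end

text \<open>Testing \<open>(norm (qft u))\<^sup>2\<close> against wide Gaussians averages the autocorrelation of \<open>u\<close>
  over narrow ones, and the autocorrelation is continuous at \<open>0\<close>.\<close>
proposition qft_Plancherel_le:
  assumes u: "integrable lborel u" and sq: "integrable lborel (\<lambda>x. (norm (u x))\<^sup>2)"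
  shows "ennreal (LINT x|lborel. (norm (u x))\<^sup>2) \<le> (\<integral>\<^sup>+ \<omega>. ennreal ((norm (qft u \<omega>))\<^sup>2) \<partial>lborel)"
proof -
  have meas [measurable]: "u \<in> borel_measurable borel"
    using borel_measurable_integrable [OF u] by simp
  interpret L2_function u using sq by unfold_locales simp
  \<comment> \<open>On the frequency side the density bound \<open>1 / (2 * pi)\<close> and the
    Jacobian \<open>(2 * pi * \<sigma>)\<^sup>2\<close> combine to
    \<open>2 * pi * \<sigma>\<^sup>2\<close>. The position side yields exactly the same factor, so
    it cancels and no constant is lost.\<close>
  have le: "ennreal (LINT z|gauss_plane. autocorr (\<sigma> *\<^sub>R z)) \<le> (\<integral>\<^sup>+ \<omega>. ennreal ((norm (qft u \<omega>))\<^sup>2) \<partial>lborel)"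
    if \<sigma>: "\<sigma> > 0" for \<sigma>
  proof -
    let ?g = "\<lambda>z. exp (- (norm z)\<^sup>2 / 2) / (2 * pi) :: real"
    let ?q = "\<lambda>z. qft u (z /\<^sub>R (2 * pi * \<sigma>))"
    have "norm (qft u \<omega>) \<le> (LINT x|lborel. norm (u x))" for \<omega>
      unfolding qft_def by (rule order.trans [OF integral_norm_bound]) simp
    hence "integrable gauss_plane (\<lambda>z. (norm (?q z))\<^sup>2)"
      by (intro gauss_plane.integrable_const_bound [where B = "(LINT x|lborel. norm (u x))\<^sup>2"])
         (auto intro!: power_mono)
    hence "ennreal (LINT z|gauss_plane. (norm (?q z))\<^sup>2) = (\<integral>\<^sup>+ z. ennreal ((norm (?q z))\<^sup>2) \<partial>gauss_plane)"
      by (subst nn_integral_eq_integral) auto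
    also have "\<dots> = (\<integral>\<^sup>+ z. ennreal (?g z) * ennreal ((norm (?q z))\<^sup>2) \<partial>lborel)"
      unfolding gauss_plane_density by (subst nn_integral_density) auto
    also have "\<dots> \<le> (\<integral>\<^sup>+ z. ennreal (1 / (2 * pi)) * ennreal ((norm (?q z))\<^sup>2) \<partial>lborel)"
      by (intro nn_integral_mono mult_right_mono ennreal_leI divide_right_mono) auto
    also have "\<dots> = ennreal (1 / (2 * pi)) * (\<integral>\<^sup>+ z. ennreal ((norm (?q z))\<^sup>2) \<partial>lborel)"
      by (subst nn_integral_cmult) auto
    also have "(\<integral>\<^sup>+ z. ennreal ((norm (?q z))\<^sup>2) \<partial>lborel) =
        ennreal ((2 * pi * \<sigma>) ^ 2) * (\<integral>\<^sup>+ \<omega>. ennreal ((norm (qft u \<omega>))\<^sup>2) \<partial>lborel)"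
    proof -
      define c where "c = 2 * pi * \<sigma>"
      have "c > 0" using \<sigma> by (simp add: c_def)
      thus ?thesis
        unfolding c_def [symmetric] by (subst nn_integral_scaleR [of _ c]) simp_all
    qed
    also have "ennreal (1 / (2 * pi)) * (ennreal ((2 * pi * \<sigma>) ^ 2) * (\<integral>\<^sup>+ \<omega>. ennreal ((norm (qft u \<omega>))\<^sup>2) \<partial>lborel))
        = ennreal (2 * pi * \<sigma>\<^sup>2) * (\<integral>\<^sup>+ \<omega>. ennreal ((norm (qft u \<omega>))\<^sup>2) \<partial>lborel)"
      by (subst mult.assoc [symmetric], subst ennreal_mult' [symmetric]) (simp_all add: power2_eq_square mult.assoc)
    finally have 1: "ennreal (LINT z|gauss_plane. (norm (?q z))\<^sup>2) \<le> \<dots>" .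
    have "(LINT z|gauss_plane. (norm (?q z))\<^sup>2) = (LINT z|lborel. exp (- (norm (z /\<^sub>R \<sigma>))\<^sup>2 / 2) * autocorr z)"
      by (simp only: gauss_plane_integral_qft [OF u \<sigma>] gauss_plane_autocorr [OF u \<sigma>])
    also have "\<dots> = \<sigma>\<^sup>2 * (LINT z|lborel. exp (- (norm z)\<^sup>2 / 2) * autocorr (\<sigma> *\<^sub>R z))"
      using \<sigma> by (subst integral_scaleR [of _ \<sigma>]) simp_all
    also have "(LINT z|lborel. exp (- (norm z)\<^sup>2 / 2) * autocorr (\<sigma> *\<^sub>R z)) =
        2 * pi * (LINT z|lborel. ?g z * autocorr (\<sigma> *\<^sub>R z))"
      by simp
    also have "(LINT z|lborel. ?g z * autocorr (\<sigma> *\<^sub>R z)) = (LINT z|gauss_plane. autocorr (\<sigma> *\<^sub>R z))"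
      unfolding gauss_plane_density by (subst integral_density) auto
    finally have 2: "(LINT z|gauss_plane. (norm (?q z))\<^sup>2) = (2 * pi * \<sigma>\<^sup>2) * (LINT z|gauss_plane. autocorr (\<sigma> *\<^sub>R z))"
      by simp
    have "ennreal (2 * pi * \<sigma>\<^sup>2) * ennreal (LINT z|gauss_plane. autocorr (\<sigma> *\<^sub>R z))
        \<le> ennreal (2 * pi * \<sigma>\<^sup>2) * (\<integral>\<^sup>+ \<omega>. ennreal ((norm (qft u \<omega>))\<^sup>2) \<partial>lborel)"
      using 1 unfolding 2 by (simp add: ennreal_mult')
    thus ?thesis
      using \<sigma> by (subst (asm) ennreal_mult_le_mult_iff) auto
  qed
  have "(\<lambda>n. LINT z|gauss_plane. autocorr ((1 / real (Suc n)) *\<^sub>R z)) \<longlonglongrightarrow> (LINT z|gauss_plane. autocorr 0)"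
  proof (rule integral_dominated_convergence [where w = "\<lambda>_. autocorr 0"])
    have cont: "isCont autocorr 0" using autocorr_tendsto by (simp add: isCont_def)
    show "AE z in gauss_plane. (\<lambda>n. autocorr ((1 / real (Suc n)) *\<^sub>R z)) \<longlonglongrightarrow> autocorr 0"
    proof (intro AE_I2 isCont_tendsto_compose [OF cont])
      fix z :: "real^2"
      show "(\<lambda>n. (1 / real (Suc n)) *\<^sub>R z) \<longlonglongrightarrow> 0"
        using tendsto_scaleR [OF lim_1_over_n [THEN LIMSEQ_Suc] tendsto_const [of z]] by simp
    qed
  qed (use autocorr_le in auto)
  hence "(\<lambda>n. ennreal (LINT z|gauss_plane. autocorr ((1 / real (Suc n)) *\<^sub>R z))) \<longlonglongrightarrow> ennreal (autocorr 0)"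
    by (intro tendsto_ennrealI) (simp add: gauss_plane.prob_space)
  hence "ennreal (autocorr 0) \<le> (\<integral>\<^sup>+ \<omega>. ennreal ((norm (qft u \<omega>))\<^sup>2) \<partial>lborel)"
    by (rule LIMSEQ_le_const2) (auto intro!: le)
  thus ?thesis by (simp add: autocorr_0)
qed

section \<open>Heisenberg's inequality by symmetric differences\<close>

lemma Cauchy_Schwarz_integral:
  fixes f g :: "'a \<Rightarrow> 'b::euclidean_space"
  assumes [measurable]: "f \<in> borel_measurable M" "g \<in> borel_measurable M"
    and f: "integrable M (\<lambda>x. (norm (f x))\<^sup>2)" and g: "integrable M (\<lambda>x. (norm (g x))\<^sup>2)"
  shows "\<bar>LINT x|M. inner (f x) (g x)\<bar> \<le> sqrt (LINT x|M. (norm (f x))\<^sup>2) * sqrt (LINT x|M. (norm (g x))\<^sup>2)"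
proof -
  let ?I = "LINT x|M. norm (inner (f x) (g x))"
  let ?F = "LINT x|M. (norm (f x))\<^sup>2" and ?G = "LINT x|M. (norm (g x))\<^sup>2"
  have "ennreal ?I = (\<integral>\<^sup>+ x. ennreal (norm (inner (f x) (g x))) \<partial>M)"
    by (intro nn_integral_eq_integral [symmetric] integrable_norm integrable_inner_L2 f g) auto
  also have "\<dots> \<le> (\<integral>\<^sup>+ x. ennreal (norm (f x)) * ennreal (norm (g x)) \<partial>M)"
    by (intro nn_integral_mono) (auto simp: Cauchy_Schwarz_ineq2 intro!: ennreal_leI simp flip: ennreal_mult)
  finally have "(ennreal ?I)\<^sup>2 \<le> (\<integral>\<^sup>+ x. ennreal (norm (f x)) * ennreal (norm (g x)) \<partial>M)\<^sup>2"
    by (intro power_mono) auto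
  also have "\<dots> \<le> (\<integral>\<^sup>+ x. (ennreal (norm (f x)))\<^sup>2 \<partial>M) * (\<integral>\<^sup>+ x. (ennreal (norm (g x)))\<^sup>2 \<partial>M)"
    by (rule Cauchy_Schwarz_nn_integral) auto
  also have "(\<integral>\<^sup>+ x. (ennreal (norm (f x)))\<^sup>2 \<partial>M) = ennreal ?F"
    using f by (simp add: ennreal_power nn_integral_eq_integral)
  also have "(\<integral>\<^sup>+ x. (ennreal (norm (g x)))\<^sup>2 \<partial>M) = ennreal ?G"
    using g by (simp add: ennreal_power nn_integral_eq_integral)
  also have "ennreal ?F * ennreal ?G = ennreal (?F * ?G)"
    by (intro ennreal_mult [symmetric]) auto
  finally have "?I\<^sup>2 \<le> ?F * ?G"
    by (subst (asm) ennreal_power) (auto simp: ennreal_le_iff)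
  hence "?I \<le> sqrt (?F * ?G)" by (rule real_le_rsqrt)
  moreover have "\<bar>LINT x|M. inner (f x) (g x)\<bar> \<le> ?I"
    using integral_norm_bound [of M "\<lambda>x. inner (f x) (g x)"] by simp
  ultimately show ?thesis unfolding real_sqrt_mult by linarith
qed

context L2_function
begin

text \<open>Shifting the variable in \<open>L x * inner (u x) (u (x - v))\<close> gives an exact difference analogue
  of the integration by parts behind Heisenberg's inequality, without any differentiability.\<close>
lemma position_difference_identity:
  fixes L :: "'a \<Rightarrow> real"
  assumes L: "bounded_linear L" and X: "integrable lborel (\<lambda>x. (L x)\<^sup>2 * (norm (u x))\<^sup>2)"
  shows "(LINT x|lborel. inner (L x *\<^sub>R u x) (u (x + v) - u (x - v))) = - (L v * autocorr v)"
proof -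
  have [measurable]: "L \<in> borel_measurable borel"
    using L by (intro borel_measurable_continuous_onI linear_continuous_on)
  have int: "integrable lborel (\<lambda>x. inner (L x *\<^sub>R u x) (u (x + z)))" for z
    using X sq_int_translation by (intro integrable_inner_L2) (auto simp: power_mult_distrib)
  have int2: "integrable lborel (\<lambda>x. L x * inner (u (x + v)) (u x))"
    using int [of v] by (simp add: inner_commute)
  have "(LINT x|lborel. inner (L x *\<^sub>R u x) (u (x + - v)))
      = (LINT x|lborel. inner (L (x + v) *\<^sub>R u (x + v)) (u x))"
    using borel_integral_translation [of "\<lambda>x. inner (L x *\<^sub>R u x) (u (x + - v))" v] by simp
  also have "\<dots> = (LINT x|lborel. L x * inner (u (x + v)) (u x) + L v * inner (u (x + v)) (u x))"
    using L by (simp add: linear_simps algebra_simps)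
  also have "\<dots> = (LINT x|lborel. L x * inner (u (x + v)) (u x)) + L v * autocorr v"
    using int2 integrable_inner_translation [of v 0]
    by (simp add: autocorr_def inner_commute)
  finally have "(LINT x|lborel. inner (L x *\<^sub>R u x) (u (x + - v))) =
      (LINT x|lborel. inner (L x *\<^sub>R u x) (u (x + v))) + L v * autocorr v"
    by (simp add: inner_commute)
  thus ?thesis
    using int [of v] int [of "- v"] by (simp add: inner_diff_right)
qed

text \<open>The constant \<open>C\<close> stands in for twice the norm of the derivative of
  \<open>u\<close> along \<open>v\<close>. Cauchy-Schwarz in
  \<open>position_difference_identity\<close> at \<open>t *\<^sub>R v\<close> leaves a factor
  \<open>t\<close> on both sides; after division, continuity of the autocorrelation at 0 turns
  \<open>autocorr (t *\<^sub>R v)\<close> into the squared norm.\<close>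

proposition Heisenberg_difference:
  fixes L :: "'a \<Rightarrow> real"
  assumes L: "bounded_linear L" "L v = 1" and X: "integrable lborel (\<lambda>x. (L x)\<^sup>2 * (norm (u x))\<^sup>2)"
    and C: "C \<ge> 0" "\<And>t. t > 0 \<Longrightarrow>
      (LINT x|lborel. (norm (u (x + t *\<^sub>R v) - u (x - t *\<^sub>R v)))\<^sup>2) \<le> (t * C)\<^sup>2"
  shows "(LINT x|lborel. (norm (u x))\<^sup>2) \<le> C * sqrt (LINT x|lborel. (L x)\<^sup>2 * (norm (u x))\<^sup>2)"
proof -
  have [measurable]: "L \<in> borel_measurable borel"
    using L by (intro borel_measurable_continuous_onI linear_continuous_on)
  let ?X = "LINT x|lborel. (L x)\<^sup>2 * (norm (u x))\<^sup>2"
  have le: "autocorr (t *\<^sub>R v) \<le> C * sqrt ?X" if t: "t > 0" for t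
  proof -
    let ?D = "\<lambda>x. u (x + t *\<^sub>R v) - u (x - t *\<^sub>R v)"
    have D: "integrable lborel (\<lambda>x. (norm (?D x))\<^sup>2)"
      using integrable_sq_diff [of "t *\<^sub>R v" "- t *\<^sub>R v"] by simp
    have "t * autocorr (t *\<^sub>R v) \<le> \<bar>LINT x|lborel. inner (L x *\<^sub>R u x) (?D x)\<bar>"
      using position_difference_identity [OF L(1) X, of "t *\<^sub>R v"] L by (simp add: linear_simps)
    also have "\<dots> \<le> sqrt (LINT x|lborel. (norm (L x *\<^sub>R u x))\<^sup>2) * sqrt (LINT x|lborel. (norm (?D x))\<^sup>2)"
      using X D by (intro Cauchy_Schwarz_integral) (auto simp: power_mult_distrib)
    also have "\<dots> \<le> sqrt ?X * (t * C)"
      using C t by (intro mult_mono real_le_lsqrt) (auto simp: power_mult_distrib)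
    finally have "t * autocorr (t *\<^sub>R v) \<le> t * (C * sqrt ?X)" by (simp add: mult_ac)
    thus ?thesis using t by simp
  qed
  have "isCont autocorr 0" using autocorr_tendsto by (simp add: isCont_def)
  hence "(\<lambda>n. autocorr ((1 / real (Suc n)) *\<^sub>R v)) \<longlonglongrightarrow> autocorr 0"
  proof (rule isCont_tendsto_compose)
    show "(\<lambda>n. (1 / real (Suc n)) *\<^sub>R v) \<longlonglongrightarrow> 0"
      using tendsto_scaleR [OF lim_1_over_n [THEN LIMSEQ_Suc] tendsto_const [of v]] by simp
  qed
  hence "autocorr 0 \<le> C * sqrt ?X"
    by (rule LIMSEQ_le_const2) (auto intro!: le)
  thus ?thesis by (simp add: autocorr_0)
qed

end

section \<open>The Gabor transform\<close>

lemma bounded_linear_qker: "bounded_linear (qker a b)"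
proof (rule bounded_linear_intro [where K = 1])
  show "norm (qker a b q) \<le> norm q * 1" for q by simp
qed (simp_all add: qker_def algebra_simps)

lemma qker_add: "qker (a + a') (b + b') q = qker a b (qker a' b' q)"
proof -
  have "exp (- ((a + a') *\<^sub>R quat_i)) = exp (- (a *\<^sub>R quat_i)) * exp (- (a' *\<^sub>R quat_i))"
    unfolding quat_exp_i by (simp add: quat_eq_iff cos_add sin_add)
  \<comment> \<open>The factors appear in reverse order because right multiplications nest outward:
    the phase \<open>b'\<close> acts on \<open>q\<close> first.\<close>
  moreover have "exp (- ((b + b') *\<^sub>R quat_j)) = exp (- (b' *\<^sub>R quat_j)) * exp (- (b *\<^sub>R quat_j))"
    unfolding quat_exp_j by (simp add: quat_eq_iff cos_add sin_add)
  ultimately show ?thesis by (simp add: qker_def mult.assoc)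
qed

text \<open>Substituting \<open>x - s\<close> for \<open>x\<close> adds phases independent of
  \<open>x\<close>. By \<open>qker_add\<close> they act outside the kernel, and as a bounded linear
  map they pass through the integral.\<close>

lemma qft_translation:
  assumes u: "integrable lborel u"
  shows "qft (\<lambda>x. u (x + s)) \<omega> = qker (- 2 * pi * s$1 * \<omega>$1) (- 2 * pi * s$2 * \<omega>$2) (qft u \<omega>)"
proof -
  have [measurable]: "u \<in> borel_measurable borel"
    using borel_measurable_integrable [OF u] by simp
  let ?E = "\<lambda>x. qker (2 * pi * x$1 * \<omega>$1) (2 * pi * x$2 * \<omega>$2)"
  have "qft (\<lambda>x. u (x + s)) \<omega> = (LINT x|lborel. ?E (x + s - s) (u (x + s)))"
    by (simp add: qft_def)
  also have "\<dots> = (LINT x|lborel. ?E (x - s) (u x))"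
    by (rule borel_integral_translation) measurable
  also have "\<dots> = (LINT x|lborel. qker (- 2 * pi * s$1 * \<omega>$1) (- 2 * pi * s$2 * \<omega>$2) (?E x (u x)))"
    by (simp add: algebra_simps flip: qker_add)
  also have "\<dots> = qker (- 2 * pi * s$1 * \<omega>$1) (- 2 * pi * s$2 * \<omega>$2) (qft u \<omega>)"
    unfolding qft_def
    using integrable_qker [OF u, of "2 * pi * \<omega>$1" "2 * pi * \<omega>$2"]
    by (intro integral_bounded_linear bounded_linear_qker) (simp add: mult_ac)
  finally show ?thesis .
qed

lemma qft_diff:
  assumes u: "integrable lborel u" and v: "integrable lborel v"
  shows "qft (\<lambda>x. u x - v x) \<omega> = qft u \<omega> - qft v \<omega>"
proof -
  have "qker a b (p - q) = qker a b p - qker a b q" for a b p q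
    by (simp add: qker_def algebra_simps)
  moreover have "integrable lborel (\<lambda>x. qker (2 * pi * x$1 * \<omega>$1) (2 * pi * x$2 * \<omega>$2) (w x))"
    if "integrable lborel w" for w :: "real^2 \<Rightarrow> quat"
    using integrable_qker [OF that, of "2 * pi * \<omega>$1" "2 * pi * \<omega>$2"] by (simp add: mult_ac)
  ultimately show ?thesis
    using u v by (simp add: qft_def)
qed

lemma norm_quat_units [simp]: "norm quat_i = 1" "norm quat_j = 1"
  by (simp_all add: norm_quat)

lemma norm_qft_difference:
  assumes u: "integrable lborel u"
  shows "norm (qft (\<lambda>x. u (x + t *\<^sub>R axis k 1) - u (x - t *\<^sub>R axis k 1)) \<omega>) =
    2 * \<bar>sin (2 * pi * t * \<omega>$k)\<bar> * norm (qft u \<omega>)"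
proof -
  let ?Q = "qft u \<omega>" and ?a = "2 * pi * t * \<omega>$k"
  have 1: "qker (- a) 0 q - qker a 0 q = (2 * sin a) *\<^sub>R (quat_i * q)"
    and 2: "qker 0 (- a) q - qker 0 a q = (2 * sin a) *\<^sub>R (q * quat_j)" for a q
    by (simp_all add: qker_expand flip: scaleR_left_distrib)
  \<comment> \<open>A shift along one axis changes only one phase: the left one for the first
    coordinate, the right one for the second.\<close>
  have T: "qft (\<lambda>x. u (x + s *\<^sub>R axis k 1)) \<omega> =
      (if k = 1 then qker (- (2 * pi * s * \<omega>$k)) 0 ?Q else qker 0 (- (2 * pi * s * \<omega>$k)) ?Q)" for s
    using exhaust_2 [of k] by (subst qft_translation [OF u]) (auto simp: axis_def)
  have "qft (\<lambda>x. u (x + t *\<^sub>R axis k 1) - u (x + (- t) *\<^sub>R axis k 1)) \<omega> =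
      qft (\<lambda>x. u (x + t *\<^sub>R axis k 1)) \<omega> - qft (\<lambda>x. u (x + (- t) *\<^sub>R axis k 1)) \<omega>"
    by (intro qft_diff borel_integrable_translation u)
  also have "\<dots> = (if k = 1 then (2 * sin ?a) *\<^sub>R (quat_i * ?Q) else (2 * sin ?a) *\<^sub>R (?Q * quat_j))"
    unfolding T by (simp add: 1 2)
  finally show ?thesis by (simp add: norm_mult abs_mult)
qed

text \<open>Plancherel is applied to the difference itself, whose transform is a multiple of
  \<open>qft u\<close>; \<open>\<bar>sin x\<bar> \<le> \<bar>x\<bar>\<close> then gives the constant
  \<open>4 * pi * t\<close>.\<close>

lemma qft_difference_bound:
  assumes u: "integrable lborel u" and sq: "integrable lborel (\<lambda>x. (norm (u x))\<^sup>2)"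
  shows "(\<integral>\<^sup>+ x. ennreal ((norm (u (x + t *\<^sub>R axis k 1) - u (x - t *\<^sub>R axis k 1)))\<^sup>2) \<partial>lborel)
    \<le> ennreal ((4 * pi * t)\<^sup>2) * (\<integral>\<^sup>+ \<omega>. ennreal ((\<omega>$k)\<^sup>2 * (norm (qft u \<omega>))\<^sup>2) \<partial>lborel)"
proof -
  have [measurable]: "u \<in> borel_measurable borel"
    using borel_measurable_integrable [OF u] by simp
  interpret L2_function u using sq by unfold_locales simp
  let ?D = "\<lambda>x. u (x + t *\<^sub>R axis k 1) - u (x - t *\<^sub>R axis k 1)"
  have D: "integrable lborel ?D"
    using borel_integrable_translation [OF u, of "t *\<^sub>R axis k 1"]
      borel_integrable_translation [OF u, of "- t *\<^sub>R axis k 1"] by simp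
  have D2: "integrable lborel (\<lambda>x. (norm (?D x))\<^sup>2)"
    using integrable_sq_diff [of "t *\<^sub>R axis k 1" "- t *\<^sub>R axis k 1"] by simp
  have "(\<integral>\<^sup>+ x. ennreal ((norm (?D x))\<^sup>2) \<partial>lborel) = ennreal (LINT x|lborel. (norm (?D x))\<^sup>2)"
    using D2 by (intro nn_integral_eq_integral) auto
  also have "\<dots> \<le> (\<integral>\<^sup>+ \<omega>. ennreal ((norm (qft ?D \<omega>))\<^sup>2) \<partial>lborel)"
    by (rule qft_Plancherel_le [OF D D2])
  also have "\<dots> \<le> (\<integral>\<^sup>+ \<omega>. ennreal ((4 * pi * t)\<^sup>2) * ennreal ((\<omega>$k)\<^sup>2 * (norm (qft u \<omega>))\<^sup>2) \<partial>lborel)"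
  proof (rule nn_integral_mono)
    fix \<omega> :: "real^2"
    have "norm (qft ?D \<omega>) \<le> 2 * \<bar>2 * pi * t * \<omega>$k\<bar> * norm (qft u \<omega>)"
      unfolding norm_qft_difference [OF u]
      by (intro mult_right_mono mult_left_mono abs_sin_x_le_abs_x) auto
    hence "(norm (qft ?D \<omega>))\<^sup>2 \<le> (2 * \<bar>2 * pi * t * \<omega>$k\<bar> * norm (qft u \<omega>))\<^sup>2"
      by (rule power_mono) simp
    also have "\<dots> = (4 * pi * t)\<^sup>2 * ((\<omega>$k)\<^sup>2 * (norm (qft u \<omega>))\<^sup>2)"
      by (simp add: power_mult_distrib)
    finally show "ennreal ((norm (qft ?D \<omega>))\<^sup>2) \<le>
        ennreal ((4 * pi * t)\<^sup>2) * ennreal ((\<omega>$k)\<^sup>2 * (norm (qft u \<omega>))\<^sup>2)"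
      by (simp add: ennreal_leI flip: ennreal_mult)
  qed
  also have "\<dots> = ennreal ((4 * pi * t)\<^sup>2) * (\<integral>\<^sup>+ \<omega>. ennreal ((\<omega>$k)\<^sup>2 * (norm (qft u \<omega>))\<^sup>2) \<partial>lborel)"
    by (subst nn_integral_cmult) simp_all
  finally show ?thesis .
qed

text \<open>The line \<open>\<omega>$k = 0\<close> is null, so a vanishing moment forces the
  transform to vanish almost everywhere, and the Plancherel inequality forces \<open>u\<close> to do
  so.\<close>

lemma qft_eq_0_imp:
  assumes u: "integrable lborel u" and sq: "integrable lborel (\<lambda>x. (norm (u x))\<^sup>2)"
    and 0: "(\<integral>\<^sup>+ \<omega>. ennreal ((\<omega>$k)\<^sup>2 * (norm (qft u \<omega>))\<^sup>2) \<partial>lborel) = 0"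
  shows "(\<integral>\<^sup>+ x. ennreal ((norm (u x))\<^sup>2) \<partial>lborel) = 0"
proof -
  have [measurable]: "u \<in> borel_measurable borel"
    using borel_measurable_integrable [OF u] by simp
  have "AE \<omega> in lborel. (\<omega>$k)\<^sup>2 * (norm (qft u \<omega>))\<^sup>2 = 0"
    using 0 by (subst (asm) nn_integral_0_iff_AE) (auto simp: ennreal_eq_0_iff mult_le_0_iff)
  moreover have "AE \<omega>::real^2 in lborel. \<omega>$k \<noteq> 0"
    using AE_lborel_inner_neq [of "axis k 1 :: real^2" 0] by (simp add: inner_axis)
  ultimately have "AE \<omega> in lborel. ennreal ((norm (qft u \<omega>))\<^sup>2) = 0"
    by eventually_elim simp
  hence "(\<integral>\<^sup>+ \<omega>. ennreal ((norm (qft u \<omega>))\<^sup>2) \<partial>lborel) = 0"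
    by (subst nn_integral_0_iff_AE) auto
  with qft_Plancherel_le [OF u sq] show ?thesis
    using sq by (subst nn_integral_eq_integral) auto
qed

lemma nn_integral_reflection:
  fixes f :: "'a::euclidean_space \<Rightarrow> ennreal"
  assumes [measurable]: "f \<in> borel_measurable borel"
  shows "(\<integral>\<^sup>+ b. f (x - b) \<partial>lborel) = (\<integral>\<^sup>+ y. f y \<partial>lborel)"
  by (subst (2) lborel_affine [of "-1" x])
    (simp_all add: nn_integral_density nn_integral_distr)

lemma esqrt_0_iff [simp]: "esqrt x = 0 \<longleftrightarrow> x = 0"
proof
  show "x = 0" if "esqrt x = 0" using esqrt_square [of x] that by simp
qed (simp add: esqrt_def)

section \<open>The Gabor product as one function of position and window shift\<close>

definition gabor_product :: "(real^2 \<Rightarrow> quat) \<Rightarrow> (real^2 \<Rightarrow> quat) \<Rightarrow> real^2 \<Rightarrow> real^2 \<Rightarrow> quat" where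
  "gabor_product \<phi> f b x = f x * qcnj (\<phi> (x - b))"

text \<open>With Borel functions everything lives on \<open>lborel\<close>, which on a product space
  is the product of the factors; this fails for the completed measures. Lebesgue measurable
  functions are reduced to this case at the end.\<close>

locale gabor_pair =
  fixes \<phi> f :: "real^2 \<Rightarrow> quat"
  assumes meas [measurable]: "\<phi> \<in> borel_measurable borel" "f \<in> borel_measurable borel"
    and sq: "integrable lborel (\<lambda>x. (norm (\<phi> x))\<^sup>2)" "integrable lborel (\<lambda>x. (norm (f x))\<^sup>2)"
begin

abbreviation "P \<equiv> LINT x|lborel. (norm (\<phi> x))\<^sup>2"
abbreviation "F \<equiv> LINT x|lborel. (norm (f x))\<^sup>2"

lemma measurable_gabor_product [measurable]: "gabor_product \<phi> f b \<in> borel_measurable borel"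
  unfolding gabor_product_def by measurable

definition \<Phi> :: "(real^2) \<times> (real^2) \<Rightarrow> quat" where
  "\<Phi> p = gabor_product \<phi> f (snd p) (fst p)"

lemma measurable_\<Phi> [measurable]: "\<Phi> \<in> borel_measurable borel"
  unfolding \<Phi>_def gabor_product_def borel_prod [symmetric] by measurable

text \<open>Holds for every \<open>b\<close>, since a product of two square-integrable functions is
  integrable.\<close>

lemma integrable_gabor_product: "integrable lborel (gabor_product \<phi> f b)"
proof (rule Bochner_Integration.integrable_bound)
  have "integrable lborel (\<lambda>x. (norm (\<phi> (x - b)))\<^sup>2)"
    using borel_integrable_translation [OF sq(1), of "- b"] by simp
  thus "integrable lborel (\<lambda>x. ((norm (f x))\<^sup>2 + (norm (\<phi> (x - b)))\<^sup>2) / 2)"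
    using sq(2) by simp
  show "AE x in lborel. norm (gabor_product \<phi> f b x) \<le> norm (((norm (f x))\<^sup>2 + (norm (\<phi> (x - b)))\<^sup>2) / 2)"
  proof (intro AE_I2)
    fix x
    show "norm (gabor_product \<phi> f b x) \<le> norm (((norm (f x))\<^sup>2 + (norm (\<phi> (x - b)))\<^sup>2) / 2)"
      using sum_squares_bound [of "norm (f x)" "norm (\<phi> (x - b))"]
      by (simp add: gabor_product_def norm_mult)
  qed
qed simp

text \<open>Tonelli with \<open>b\<close> integrated first: reflection and translation invariance
  make the inner integral of the window independent of \<open>x\<close>. The weight 1 yields the
  norm of \<open>\<Phi>\<close>, the weight \<open>(x$k)\<^sup>2\<close> its position
  moment.\<close>

lemma nn_integral_\<Phi>:
  assumes [measurable]: "w \<in> borel_measurable borel" and w: "\<And>x. w x \<ge> 0"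
  shows "(\<integral>\<^sup>+ p. ennreal (w (fst p) * (norm (\<Phi> p))\<^sup>2) \<partial>lborel) =
    (\<integral>\<^sup>+ x. ennreal (w x * (norm (f x))\<^sup>2) \<partial>lborel) * ennreal P"
proof -
  have P: "(\<integral>\<^sup>+ y. ennreal ((norm (\<phi> y))\<^sup>2) \<partial>lborel) = ennreal P"
    using sq(1) by (intro nn_integral_eq_integral) auto
  have [measurable]: "(\<lambda>p. ennreal (w (fst p) * (norm (\<Phi> p))\<^sup>2)) \<in> borel_measurable (lborel \<Otimes>\<^sub>M lborel)"
    unfolding \<Phi>_def gabor_product_def by measurable
  have "(\<integral>\<^sup>+ p. ennreal (w (fst p) * (norm (\<Phi> p))\<^sup>2) \<partial>lborel) =
      (\<integral>\<^sup>+ x. \<integral>\<^sup>+ b. ennreal (w x * (norm (\<Phi> (x, b)))\<^sup>2) \<partial>lborel \<partial>lborel)"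
    unfolding lborel_prod [symmetric] by (subst lborel.nn_integral_fst [symmetric]) simp_all
  also have "\<dots> = (\<integral>\<^sup>+ x. \<integral>\<^sup>+ b. ennreal (w x * (norm (f x))\<^sup>2) * ennreal ((norm (\<phi> (x - b)))\<^sup>2) \<partial>lborel \<partial>lborel)"
    by (simp add: \<Phi>_def gabor_product_def norm_mult power_mult_distrib w mult.assoc flip: ennreal_mult)
  also have "\<dots> = (\<integral>\<^sup>+ x. ennreal (w x * (norm (f x))\<^sup>2) * ennreal P \<partial>lborel)"
    by (simp add: nn_integral_cmult nn_integral_reflection [of "\<lambda>y. ennreal ((norm (\<phi> y))\<^sup>2)"] P)
  also have "\<dots> = (\<integral>\<^sup>+ x. ennreal (w x * (norm (f x))\<^sup>2) \<partial>lborel) * ennreal P"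
    by (rule nn_integral_multc) simp
  finally show ?thesis .
qed

lemma nn_integral_norm_\<Phi>: "(\<integral>\<^sup>+ p. ennreal ((norm (\<Phi> p))\<^sup>2) \<partial>lborel) = ennreal (F * P)"
proof -
  have "(\<integral>\<^sup>+ x. ennreal ((norm (f x))\<^sup>2) \<partial>lborel) = ennreal F"
    using sq(2) by (intro nn_integral_eq_integral) auto
  thus ?thesis
    using nn_integral_\<Phi> [of "\<lambda>_. 1"] by (simp add: ennreal_mult)
qed

lemma nn_integral_\<Phi>_swap:
  fixes h :: "(real^2) \<times> (real^2) \<Rightarrow> ennreal"
  assumes [measurable]: "h \<in> borel_measurable borel"
  shows "(\<integral>\<^sup>+ p. h p \<partial>lborel) = (\<integral>\<^sup>+ b. \<integral>\<^sup>+ x. h (x, b) \<partial>lborel \<partial>lborel)"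
proof -
  have [measurable]: "h \<in> borel_measurable (lborel \<Otimes>\<^sub>M lborel)"
    by (simp add: lborel_prod)
  show ?thesis
    unfolding lborel_prod [symmetric] by (rule lborel_pair.nn_integral_snd [symmetric]) simp
qed

lemma sq_integrable_\<Phi>: "integrable lborel (\<lambda>p. (norm (\<Phi> p))\<^sup>2)"
  by (rule integrableI_bounded) (simp_all add: nn_integral_norm_\<Phi>)

sublocale L2_function \<Phi>
  by unfold_locales (simp_all add: sq_integrable_\<Phi>)

lemma autocorr_0_\<Phi>: "(LINT p|lborel. (norm (\<Phi> p))\<^sup>2) = F * P"
  by (subst integral_eq_nn_integral) (simp_all add: nn_integral_norm_\<Phi>)

text \<open>A slice need not be square integrable for each \<open>b\<close>; finiteness of the joint
  integral provides this for almost every \<open>b\<close>, which suffices under the integral over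
  \<open>b\<close>.\<close>

lemma AE_sq_integrable: "AE b in lborel. integrable lborel (\<lambda>x. (norm (gabor_product \<phi> f b x))\<^sup>2)"
proof -
  have "(\<lambda>(x, b). (norm (\<Phi> (x, b)))\<^sup>2) = (\<lambda>p. (norm (\<Phi> p))\<^sup>2)" by auto
  hence "integrable (lborel \<Otimes>\<^sub>M lborel) (\<lambda>(x, b). (norm (\<Phi> (x, b)))\<^sup>2)"
    using sq_integrable_\<Phi> by (simp only: lborel_prod)
  from lborel_pair.AE_integrable_snd [OF this] show ?thesis
    by (simp add: \<Phi>_def)
qed

definition freq :: "2 \<Rightarrow> ennreal" where
  "freq k = (\<integral>\<^sup>+ b. \<integral>\<^sup>+ \<omega>. ennreal ((\<omega>$k)\<^sup>2 * (norm (qft (gabor_product \<phi> f b) \<omega>))\<^sup>2) \<partial>lborel \<partial>lborel)"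

lemma measurable_freq_integrand [measurable]:
  "(\<lambda>b. \<integral>\<^sup>+ \<omega>. ennreal ((\<omega>$k)\<^sup>2 * (norm (qft (gabor_product \<phi> f b) \<omega>))\<^sup>2) \<partial>lborel) \<in> borel_measurable borel"
  unfolding qft_def gabor_product_def by measurable

text \<open>The direction \<open>(axis k 1, 0)\<close> leaves \<open>b\<close> fixed, so the plane
  estimate applies slice by slice and is integrated over \<open>b\<close>.\<close>

lemma freq_difference_bound:
  "(\<integral>\<^sup>+ p. ennreal ((norm (\<Phi> (p + t *\<^sub>R (axis k 1, 0)) - \<Phi> (p - t *\<^sub>R (axis k 1, 0))))\<^sup>2) \<partial>lborel)
    \<le> ennreal ((4 * pi * t)\<^sup>2) * freq k"
proof -
  let ?h = "gabor_product \<phi> f"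
  have "(\<integral>\<^sup>+ p. ennreal ((norm (\<Phi> (p + t *\<^sub>R (axis k 1, 0)) - \<Phi> (p - t *\<^sub>R (axis k 1, 0))))\<^sup>2) \<partial>lborel) =
      (\<integral>\<^sup>+ b. \<integral>\<^sup>+ x. ennreal ((norm (?h b (x + t *\<^sub>R axis k 1) - ?h b (x - t *\<^sub>R axis k 1)))\<^sup>2) \<partial>lborel \<partial>lborel)"
    by (subst nn_integral_\<Phi>_swap, measurable) (simp add: \<Phi>_def)
  also have "\<dots> \<le> (\<integral>\<^sup>+ b. ennreal ((4 * pi * t)\<^sup>2) *
      (\<integral>\<^sup>+ \<omega>. ennreal ((\<omega>$k)\<^sup>2 * (norm (qft (?h b) \<omega>))\<^sup>2) \<partial>lborel) \<partial>lborel)"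
    by (rule nn_integral_mono_AE, use AE_sq_integrable in eventually_elim)
      (intro qft_difference_bound integrable_gabor_product)
  also have "\<dots> = ennreal ((4 * pi * t)\<^sup>2) * freq k"
    unfolding freq_def by (rule nn_integral_cmult) simp
  finally show ?thesis .
qed

lemma freq_eq_0_imp:
  assumes "freq k = 0"
  shows "F * P = 0"
proof -
  let ?h = "gabor_product \<phi> f"
  have "AE b in lborel. (\<integral>\<^sup>+ \<omega>. ennreal ((\<omega>$k)\<^sup>2 * (norm (qft (?h b) \<omega>))\<^sup>2) \<partial>lborel) = 0"
    using assms unfolding freq_def by (subst (asm) nn_integral_0_iff_AE) simp_all
  hence "AE b in lborel. (\<integral>\<^sup>+ x. ennreal ((norm (?h b x))\<^sup>2) \<partial>lborel) = 0"
    using AE_sq_integrable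
    by eventually_elim (rule qft_eq_0_imp [OF integrable_gabor_product])
  hence "(\<integral>\<^sup>+ b. \<integral>\<^sup>+ x. ennreal ((norm (?h b x))\<^sup>2) \<partial>lborel \<partial>lborel) = (\<integral>\<^sup>+ (b::real^2). 0 \<partial>lborel)"
    by (intro nn_integral_cong_AE)
  hence "(\<integral>\<^sup>+ p. ennreal ((norm (\<Phi> p))\<^sup>2) \<partial>lborel) = 0"
    by (subst nn_integral_\<Phi>_swap, measurable) (simp add: \<Phi>_def)
  hence "F * P \<le> 0"
    unfolding nn_integral_norm_\<Phi> by (simp add: ennreal_eq_0_iff)
  thus ?thesis by (intro antisym) auto
qed

text \<open>The difference inequality for \<open>\<Phi>\<close>, with the \<open>k\<close>-th
  position coordinate as \<open>L\<close> and \<open>C = 4 * pi * sqrt N\<close>.\<close>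

lemma Heisenberg_finite:
  assumes X: "(\<integral>\<^sup>+ x. ennreal ((x$k)\<^sup>2 * (norm (f x))\<^sup>2) \<partial>lborel) = ennreal X" "X \<ge> 0"
    and N: "freq k = ennreal N" "N \<ge> 0"
  shows "F * P \<le> 4 * pi * sqrt N * sqrt (X * P)"
proof -
  let ?L = "\<lambda>p::(real^2) \<times> (real^2). fst p $ k" and ?v = "(axis k 1, 0) :: (real^2) \<times> (real^2)"
  have L: "bounded_linear ?L"
    by (intro bounded_linear_compose [OF bounded_linear_vec_nth] bounded_linear_fst)
  have [measurable]: "?L \<in> borel_measurable borel"
    using L by (intro borel_measurable_continuous_onI linear_continuous_on)
  have nn: "(\<integral>\<^sup>+ p. ennreal ((?L p)\<^sup>2 * (norm (\<Phi> p))\<^sup>2) \<partial>lborel) = ennreal (X * P)"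
    using nn_integral_\<Phi> [of "\<lambda>x. (x$k)\<^sup>2"] X by (simp add: ennreal_mult)
  have int: "integrable lborel (\<lambda>p. (?L p)\<^sup>2 * (norm (\<Phi> p))\<^sup>2)"
    by (rule integrableI_bounded) (simp_all add: nn abs_mult)
  have eq: "(LINT p|lborel. (?L p)\<^sup>2 * (norm (\<Phi> p))\<^sup>2) = X * P"
    using X by (subst integral_eq_nn_integral) (simp_all add: nn)
  have "(LINT p|lborel. (norm (\<Phi> (p + t *\<^sub>R ?v) - \<Phi> (p - t *\<^sub>R ?v)))\<^sup>2) \<le> (t * (4 * pi * sqrt N))\<^sup>2" for t
  proof -
    have "integrable lborel (\<lambda>p. (norm (\<Phi> (p + t *\<^sub>R ?v) - \<Phi> (p - t *\<^sub>R ?v)))\<^sup>2)"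
      using integrable_sq_diff [of "t *\<^sub>R ?v" "- (t *\<^sub>R ?v)"] unfolding add_uminus_conv_diff .
    hence "ennreal (LINT p|lborel. (norm (\<Phi> (p + t *\<^sub>R ?v) - \<Phi> (p - t *\<^sub>R ?v)))\<^sup>2) =
        (\<integral>\<^sup>+ p. ennreal ((norm (\<Phi> (p + t *\<^sub>R ?v) - \<Phi> (p - t *\<^sub>R ?v)))\<^sup>2) \<partial>lborel)"
      by (intro nn_integral_eq_integral [symmetric]) auto
    also have "\<dots> \<le> ennreal ((4 * pi * t)\<^sup>2) * freq k"
      by (rule freq_difference_bound)
    also have "\<dots> = ennreal ((t * (4 * pi * sqrt N))\<^sup>2)"
      using N by (simp add: power_mult_distrib mult_ac flip: ennreal_mult)
    finally show ?thesis by (subst (asm) ennreal_le_iff) auto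
  qed
  from Heisenberg_difference [OF L _ int _ this] show ?thesis
    using N by (simp add: eq autocorr_0_\<Phi>)
qed

text \<open>In \<open>ennreal\<close>, \<open>0 * \<infinity> = 0\<close>, so an infinite moment
  makes the right side infinite only if the other moment is non-zero. Both are shown to be non-zero
  when \<open>F * P\<close> is, before the infinite case is separated.\<close>

theorem Heisenberg:
  "ennreal (1 / (4 * pi)) * ennreal F * esqrt (ennreal P) \<le>
    esqrt (\<integral>\<^sup>+ x. ennreal ((x$k)\<^sup>2 * (norm (f x))\<^sup>2) \<partial>lborel) * esqrt (freq k)"
    (is "?lhs \<le> esqrt ?X * esqrt ?N")
proof (cases "F * P = 0")
  case True
  hence "F = 0 \<or> P = 0" by simp
  hence "?lhs = 0" by (elim disjE) simp_all
  thus ?thesis by (simp only: zero_le)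
next
  case False
  have FP: "F \<ge> 0" "P \<ge> 0" by simp_all
  with False have pos: "F > 0" "P > 0" by (simp_all add: order_less_le)
  have N0: "?N \<noteq> 0" using freq_eq_0_imp False by blast
  have X0: "?X \<noteq> 0"
  proof
    assume "?X = 0"
    hence "AE x in lborel. (x$k)\<^sup>2 * (norm (f x))\<^sup>2 = 0"
      by (subst (asm) nn_integral_0_iff_AE) (auto simp: ennreal_eq_0_iff mult_le_0_iff)
    moreover have "AE x::real^2 in lborel. x$k \<noteq> 0"
      using AE_lborel_inner_neq [of "axis k 1 :: real^2" 0] by (simp add: inner_axis)
    ultimately have "AE x in lborel. (norm (f x))\<^sup>2 = 0" by eventually_elim simp
    hence "F = 0" by (rule integral_eq_zero_AE)
    with pos show False by simp
  qed
  show ?thesis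
  proof (cases "?X = \<infinity> \<or> ?N = \<infinity>")
    case True
    hence "esqrt ?X * esqrt ?N = \<infinity>"
      using N0 X0 by (auto simp: ennreal_mult_eq_top_iff) (auto simp: esqrt_def)
    thus ?thesis by simp
  next
    case False
    obtain X where X: "?X = ennreal X" "X \<ge> 0"
      using False by (cases ?X rule: ennreal_cases) simp_all
    obtain N where N: "?N = ennreal N" "N \<ge> 0"
      using False by (cases ?N rule: ennreal_cases) simp_all
    \<comment> \<open>The window contributes \<open>P\<close> to both squared norms of
      \<open>\<Phi>\<close>; splitting off \<open>sqrt P\<close> on each side lets it cancel, as
      \<open>P > 0\<close>.\<close>
    have "sqrt P * (F * sqrt P) = F * P" using FP by simp
    also have "\<dots> \<le> 4 * pi * sqrt N * sqrt (X * P)"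
      by (rule Heisenberg_finite [OF X N])
    also have "\<dots> = sqrt P * (4 * pi * (sqrt X * sqrt N))"
      by (simp add: real_sqrt_mult mult_ac)
    finally have "F * sqrt P \<le> 4 * pi * (sqrt X * sqrt N)"
      using pos by simp
    hence "1 / (4 * pi) * F * sqrt P \<le> sqrt X * sqrt N"
      by (simp add: field_simps)
    hence "ennreal (1 / (4 * pi) * F * sqrt P) \<le> ennreal (sqrt X * sqrt N)"
      by (rule ennreal_leI)
    also have "ennreal (1 / (4 * pi) * F * sqrt P) = ennreal (1 / (4 * pi)) * ennreal F * ennreal (sqrt P)"
      using FP by (subst ennreal_mult, simp, simp, subst ennreal_mult) simp_all
    also have "ennreal (sqrt X * sqrt N) = ennreal (sqrt X) * ennreal (sqrt N)"
      using X N by (intro ennreal_mult) simp_all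
    finally show ?thesis
      unfolding X(1) N(1) esqrt_ennreal [OF FP(2)] esqrt_ennreal [OF X(2)] esqrt_ennreal [OF N(2)] .
  qed
qed

end

section \<open>From Lebesgue to Borel measurable functions\<close>

text \<open>The real-valued case is applied to each coordinate; finitely many exceptional null sets
  are combined.\<close>

lemma lebesgue_ex_borel_measurable:
  fixes f :: "'a::euclidean_space \<Rightarrow> 'b::euclidean_space"
  assumes [measurable]: "f \<in> borel_measurable lebesgue"
  shows "\<exists>g\<in>borel_measurable borel. AE x in lborel. f x = g x"
proof -
  have "\<exists>g\<in>borel_measurable lborel. AE x in lborel. inner (f x) e = g x" for e
    by (rule completion_ex_borel_measurable_real) simp
  then obtain g where g: "\<And>e. g e \<in> borel_measurable lborel" "\<And>e. AE x in lborel. inner (f x) e = g e x"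
    by metis
  have "AE x in lborel. \<forall>e\<in>Basis. inner (f x) e = g e x"
    using g(2) by (intro AE_ball_countable [THEN iffD2]) (auto intro: countable_finite)
  hence "AE x in lborel. f x = (\<Sum>e\<in>Basis. g e x *\<^sub>R e)"
  proof eventually_elim
    case (elim x)
    show ?case by (subst euclidean_representation [symmetric]) (simp add: elim)
  qed
  moreover have "(\<lambda>x. \<Sum>e\<in>Basis. g e x *\<^sub>R e) \<in> borel_measurable borel"
    using g(1) by measurable
  ultimately show ?thesis by (rule bexI)
qed

lemma AE_lborel_translation:
  fixes b :: "'a::euclidean_space"
  assumes "AE x in lborel. Q x"
  shows "AE x in lborel. Q (x - b)"
proof -
  have "AE x in distr lborel borel ((+) (- b)). Q x"
    using assms unfolding lborel_distr_plus .
  from AE_distrD [OF _ this] show ?thesis by simp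
qed

lemma borel_measurable_lebesgue_AE:
  fixes f :: "'a::euclidean_space \<Rightarrow> 'b::euclidean_space"
  assumes [measurable]: "g \<in> borel_measurable borel" and AE: "AE x in lborel. f x = g x"
  shows "f \<in> borel_measurable lebesgue"
proof (rule measurableI)
  fix S :: "'b set" assume [measurable]: "S \<in> sets borel"
  have A: "g -` S \<in> sets lebesgue"
    using measurable_sets [of g borel borel S] by simp
  have ae: "AE x in lebesgue. (x \<in> g -` S) = (x \<in> f -` S)"
    by (rule AE_completion, use AE in eventually_elim) simp
  have "f -` S \<in> sets lebesgue"
    by (rule completion.in_sets_AE [OF ae A]) simp
  thus "f -` S \<inter> space lebesgue \<in> sets lebesgue" by simp
qed simp

text \<open>Translates of null sets are null, so for each fixed \<open>b\<close> the integrands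
  agree almost everywhere. The equality therefore holds at every \<open>\<omega>\<close> and
  \<open>b\<close>, not just almost everywhere.\<close>

lemma GQFT_eq_qft:
  assumes [measurable]: "\<phi>' \<in> borel_measurable borel" "f' \<in> borel_measurable borel"
    and \<phi>: "AE x in lborel. \<phi> x = \<phi>' x" and f: "AE x in lborel. f x = f' x"
  shows "GQFT \<phi> f \<omega> b = qft (gabor_product \<phi>' f' b) \<omega>"
proof -
  let ?E = "\<lambda>x. qker (2 * pi * x$1 * \<omega>$1) (2 * pi * x$2 * \<omega>$2)"
  let ?g = "\<lambda>x. ?E x (gabor_product \<phi> f b x)" and ?g' = "\<lambda>x. ?E x (gabor_product \<phi>' f' b x)"
  have [measurable]: "?g' \<in> borel_measurable borel"
    unfolding gabor_product_def by measurable
  have eq: "AE x in lborel. ?g x = ?g' x"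
    using AE_lborel_translation [OF \<phi>, of b] f by eventually_elim (simp add: gabor_product_def)
  have "GQFT \<phi> f \<omega> b = (LINT x|lebesgue. ?g x)"
    by (simp add: GQFT_def qker_def gabor_product_def mult.assoc)
  also have "\<dots> = (LINT x|lebesgue. ?g' x)"
    using eq by (intro integral_cong_AE AE_completion borel_measurable_lebesgue_AE [of ?g' ?g])
      (simp_all add: measurable_completion)
  also have "\<dots> = qft (gabor_product \<phi>' f' b) \<omega>"
    unfolding qft_def by (rule integral_completion) simp
  finally show ?thesis .
qed

lemma L2_lebesgue_borel_representative:
  fixes f :: "'a::euclidean_space \<Rightarrow> 'b::euclidean_space"
  assumes "f \<in> L2 lebesgue"
  obtains g where "g \<in> borel_measurable borel" "AE x in lborel. f x = g x"
    "integrable lborel (\<lambda>x. (norm (g x))\<^sup>2)"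
    "L2norm lebesgue f = esqrt (ennreal (LINT x|lborel. (norm (g x))\<^sup>2))"
proof -
  have f: "f \<in> borel_measurable lebesgue" "L2norm lebesgue f < \<infinity>"
    using assms by (auto simp: L2_def)
  obtain g where g [measurable]: "g \<in> borel_measurable borel" and AE: "AE x in lborel. f x = g x"
    using lebesgue_ex_borel_measurable [OF f(1)] by blast
  have eq: "(\<integral>\<^sup>+ x. ennreal ((norm (f x))\<^sup>2) \<partial>lebesgue) = (\<integral>\<^sup>+ x. ennreal ((norm (g x))\<^sup>2) \<partial>lborel)"
    unfolding nn_integral_completion
    by (intro nn_integral_cong_AE) (use AE in eventually_elim, simp)
  have "(\<integral>\<^sup>+ x. ennreal ((norm (g x))\<^sup>2) \<partial>lborel) < \<infinity>"
    using f(2) by (auto simp: L2norm_def eq esqrt_def split: if_splits simp flip: less_top)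
  hence int: "integrable lborel (\<lambda>x. (norm (g x))\<^sup>2)"
    by (intro integrableI_bounded) simp_all
  show thesis
    by (rule that [OF g AE int]) (simp add: L2norm_def eq nn_integral_eq_integral [OF int])
qed

theorem theorem4p4:
  fixes \<phi> f :: "real^2 \<Rightarrow> quat"
  assumes "\<phi> \<in> L2 lebesgue"
    and "\<not> (AE x in lebesgue. \<phi> x = 0)"
    and "f \<in> L2 lebesgue"
    and "(\<lambda>(\<omega>, b). GQFT \<phi> f \<omega> b) \<in> L2 lebesgue"
    and "\<forall>k::2. (\<lambda>(\<omega>, b). (\<omega>$k) *\<^sub>R GQFT \<phi> f \<omega> b) \<in> L2 lebesgue"
  shows "\<forall>k::2.
    esqrt (\<integral>\<^sup>+ x. ennreal ((x$k)\<^sup>2 * (norm (f x))\<^sup>2) \<partial>lebesgue) *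
    esqrt (\<integral>\<^sup>+ b. (\<integral>\<^sup>+ \<omega>. ennreal ((\<omega>$k)\<^sup>2 * (norm (GQFT \<phi> f \<omega> b))\<^sup>2) \<partial>lebesgue) \<partial>lebesgue)
    \<ge> ennreal (1 / (4 * pi)) * (L2norm lebesgue f)\<^sup>2 * L2norm lebesgue \<phi>"
proof
  fix k :: 2
  obtain \<phi>' where \<phi>': "\<phi>' \<in> borel_measurable borel" "AE x in lborel. \<phi> x = \<phi>' x"
      "integrable lborel (\<lambda>x. (norm (\<phi>' x))\<^sup>2)"
    and n\<phi>: "L2norm lebesgue \<phi> = esqrt (ennreal (LINT x|lborel. (norm (\<phi>' x))\<^sup>2))"
    using L2_lebesgue_borel_representative [OF assms(1)] by blast
  obtain f' where f': "f' \<in> borel_measurable borel" "AE x in lborel. f x = f' x"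
      "integrable lborel (\<lambda>x. (norm (f' x))\<^sup>2)"
    and nf: "L2norm lebesgue f = esqrt (ennreal (LINT x|lborel. (norm (f' x))\<^sup>2))"
    using L2_lebesgue_borel_representative [OF assms(3)] by blast
  \<comment> \<open>Borel representatives change neither the norms nor the position moment, which
    only see functions up to null sets.\<close>
  interpret gabor_pair \<phi>' f' by unfold_locales fact+
  have X: "(\<integral>\<^sup>+ x. ennreal ((x$k)\<^sup>2 * (norm (f x))\<^sup>2) \<partial>lebesgue) =
      (\<integral>\<^sup>+ x. ennreal ((x$k)\<^sup>2 * (norm (f' x))\<^sup>2) \<partial>lborel)"
    unfolding nn_integral_completion
    by (intro nn_integral_cong_AE) (use f'(2) in eventually_elim, simp)
  \<comment> \<open>Since the transforms agree at every point, the iterated integral is rewritten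
    without a null-set argument in \<open>\<omega>\<close> or \<open>b\<close>.\<close>
  have N: "(\<integral>\<^sup>+ b. (\<integral>\<^sup>+ \<omega>. ennreal ((\<omega>$k)\<^sup>2 * (norm (GQFT \<phi> f \<omega> b))\<^sup>2) \<partial>lebesgue) \<partial>lebesgue) = freq k"
    by (simp add: nn_integral_completion freq_def GQFT_eq_qft [OF \<phi>'(1) f'(1) \<phi>'(2) f'(2)])
  show "esqrt (\<integral>\<^sup>+ x. ennreal ((x$k)\<^sup>2 * (norm (f x))\<^sup>2) \<partial>lebesgue) *
    esqrt (\<integral>\<^sup>+ b. (\<integral>\<^sup>+ \<omega>. ennreal ((\<omega>$k)\<^sup>2 * (norm (GQFT \<phi> f \<omega> b))\<^sup>2) \<partial>lebesgue) \<partial>lebesgue)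
    \<ge> ennreal (1 / (4 * pi)) * (L2norm lebesgue f)\<^sup>2 * L2norm lebesgue \<phi>"
    using Heisenberg [of k] unfolding X N n\<phi> nf esqrt_square .
qed

end
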